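(* For every pair $(g_1,g_2)$ of analytic germs at zero such that $g_1(0)+g_2(0)=0$, there exists a (prenormalized) diffeomorphism $f$ from the model formal class such that the pair $(g_1,g_2)$ is realised as its $1$-moment.
   Context: Prenormalized germs from the model formal class are the analytic germs $f(z)=z+z^2+z^3+o(z^3)$ at $0\in\mathbb{C}$, i.e. those formally conjugated, by changes of variables tangent to the identity, to $f_0(z)=\frac{z}{1-z}$. Let $V_+$ be the attracting petal (around the negative real direction, tangent at $0$ to the positive real direction) and $V_-$ the repelling petal (around the positive real direction, tangent at $0$ to the negative real direction) of $f$, and $V^{up}=\{z\in V_+\cap V_-: \mathrm{Im}\,z>0\}$, $V^{low}=\{z\in V_+\cap V_-:\mathrm{Im}\,z<0\}$. Let $\Psi_+$ be the sectorial trivialization on $V_+$: the analytic solution, unique up to an additive constant, of $\Psi(f(z))-\Psi(z)=1$ on $V_+$ with asymptotic expansion in $-\frac1z+\mathbb{C}[[z]]$. $1$-moment: the $1$-Abel equation $H(f(z))-H(z)=-z$ has sectorial solutions of the form $H_\pm=-\log z+R_\pm$ on $V_\pm$, where $R_\pm$ are the analytic solutions on $V_\pm$, unique up to additive constants, of $$R(f(z))-R(z)=-z+\log\frac{f(z)}{z}$$ with a common (up to constants) asymptotic expansion in $\mathbb{C}[[z]]$ as $z\to0$. There are analytic germs $g_\infty,g_0$ at $t=0$ such that $$R_+(z)-R_-(z)=g_\infty\big(e^{2\pi i\Psi_+(z)}\big),\ z\in V^{up},\qquad R_-(z)-R_+(z)=g_0\big(e^{-2\pi i\Psi_+(z)}\big),\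 z\in V^{low},$$ and $g_\infty(0)+g_0(0)=0$. The $1$-moment of $f$ is the pair $(g_\infty,g_0)$ up to the identification of $(g_\infty^1,g_0^1)$ with $(g_\infty^2,g_0^2)$ when $g_\infty^1(t)=g_\infty^2(bt)+a$ and $g_0^1(t)=g_0^2(t/b)-a$ for some $a\in\mathbb{C}$, $b\in\mathbb{C}^*$ (reflecting the free additive constants in $\Psi_+$, $R_+$, $R_-$). The germs need not be invertible. *)

theory Defs
  imports "HOL-Complex_Analysis.Complex_Analysis" "HOL-Library.Landau_Symbols"
begin

(* Germs at 0 are represented by functions analytic at 0; only their values near 0 matter. *)

(* f 0 = 0 follows from continuity. *)
definition prenormalized :: "(complex \<Rightarrow> complex) \<Rightarrow> bool" where
  "prenormalized f \<longleftrightarrow>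
     f analytic_on {0} \<and> (\<lambda>z. f z - (z + z^2 + z^3)) \<in> o[at 0](\<lambda>z. z^3)"

definition sector :: "complex \<Rightarrow> real \<Rightarrow> complex set" where
  "sector v \<delta> = {z. z \<noteq> 0 \<and> \<bar>Arg (z / v)\<bar> < \<delta>}"

(* Invariant domain of g, attracted to 0 and centred on the direction v. It contains germs of
   all sectors around v of opening less than 2*pi, so at 0 it is tangent to the direction -v. *)
definition petal :: "(complex \<Rightarrow> complex) \<Rightarrow> complex \<Rightarrow> complex set \<Rightarrow> bool" where
  "petal g v V \<longleftrightarrow>
     open V \<and> simply_connected V \<and> 0 \<notin> V \<and> g ` V \<subseteq> V \<and>
     (\<forall>z\<in>V. (\<lambda>n. (g ^^ n) z) \<longlonglongrightarrow> 0) \<and>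
     (\<forall>\<delta>. 0 < \<delta> \<and> \<delta> < pi \<longrightarrow> (\<exists>r>0. sector v \<delta> \<inter> ball 0 r \<subseteq> V))"

definition attracting_petal :: "(complex \<Rightarrow> complex) \<Rightarrow> complex set \<Rightarrow> bool" where
  "attracting_petal f V \<longleftrightarrow>
     (\<exists>U. open U \<and> 0 \<in> U \<and> f holomorphic_on U \<and> inj_on f U \<and> V \<subseteq> U \<and> petal f (-1) V)"

(* A petal of the inverse germ, realised by the inverse of f on a neighbourhood U of 0. *)
definition repelling_petal :: "(complex \<Rightarrow> complex) \<Rightarrow> complex set \<Rightarrow> bool" where
  "repelling_petal f V \<longleftrightarrow>
     (\<exists>U. open U \<and> 0 \<in> U \<and> f holomorphic_on U \<and> inj_on f U \<and> V \<subseteq> U \<inter> f ` U \<and>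
          petal (inv_into U f) 1 V)"

(* As usual for petals, the estimates are uniform on sectors of opening less than 2*pi,
   not on the whole petal. *)
definition asymptotic_on ::
    "complex \<Rightarrow> complex set \<Rightarrow> (complex \<Rightarrow> complex) \<Rightarrow> complex fps \<Rightarrow> bool" where
  "asymptotic_on v V h a \<longleftrightarrow>
     (\<forall>\<delta> N. 0 < \<delta> \<and> \<delta> < pi \<longrightarrow>
        (\<lambda>z. h z - (\<Sum>k<N. fps_nth a k * z^k)) \<in> O[at 0 within (V \<inter> sector v \<delta>)](\<lambda>z. z^N))"

definition attracting_trivialization ::
    "(complex \<Rightarrow> complex) \<Rightarrow> complex set \<Rightarrow> (complex \<Rightarrow> complex) \<Rightarrow> bool" where
  "attracting_trivialization f V \<Psi> \<longleftrightarrow>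
     \<Psi> holomorphic_on V \<and> (\<forall>z\<in>V. \<Psi> (f z) - \<Psi> z = 1) \<and>
     (\<exists>a. asymptotic_on (-1) V (\<lambda>z. \<Psi> z + 1 / z) a)"

(* The regular part R of a solution H = - log z + R of H (f z) - H z = - z.
   On a repelling petal f z may leave V, whence the guard. *)
definition R_solution ::
    "(complex \<Rightarrow> complex) \<Rightarrow> complex set \<Rightarrow> (complex \<Rightarrow> complex) \<Rightarrow> bool" where
  "R_solution f V R \<longleftrightarrow>
     R holomorphic_on V \<and> (\<forall>z\<in>V. f z \<in> V \<longrightarrow> R (f z) - R z = - z + Ln (f z / z))"

(* The germs are evaluated on all of Vp \<inter> Vm: the petals can be taken so small that
   exp (2 pi i Psi), exp (- 2 pi i Psi) stay where the germs are analytic. The sectors in petal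
   force the values of these exponentials to fill a punctured neighbourhood of 0. *)
definition one_moment_pair ::
    "(complex \<Rightarrow> complex) \<Rightarrow> (complex \<Rightarrow> complex) \<Rightarrow> (complex \<Rightarrow> complex) \<Rightarrow> bool" where
  "one_moment_pair f g_inf g_zero \<longleftrightarrow>
     g_inf analytic_on {0} \<and> g_zero analytic_on {0} \<and>
     (\<exists>Vp Vm \<Psi> Rp Rm r c.
        attracting_petal f Vp \<and> repelling_petal f Vm \<and>
        attracting_trivialization f Vp \<Psi> \<and>
        R_solution f Vp Rp \<and> asymptotic_on (-1) Vp Rp r \<and>
        R_solution f Vm Rm \<and> asymptotic_on 1 Vm Rm (r + fps_const c) \<and>
        (\<forall>z \<in> Vp \<inter> Vm. Im z > 0 \<longrightarrow> Rp z - Rm z = g_inf (exp (2 * pi * \<i> * \<Psi> z))) \<and>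
        (\<forall>z \<in> Vp \<inter> Vm. Im z < 0 \<longrightarrow> Rm z - Rp z = g_zero (exp (- 2 * pi * \<i> * \<Psi> z))))"

definition moment_equiv ::
    "(complex \<Rightarrow> complex) \<times> (complex \<Rightarrow> complex) \<Rightarrow>
     (complex \<Rightarrow> complex) \<times> (complex \<Rightarrow> complex) \<Rightarrow> bool" where
  "moment_equiv g h \<longleftrightarrow>
     (\<exists>a b. b \<noteq> 0 \<and> (\<forall>\<^sub>F t in nhds 0. fst g t = fst h (b * t) + a) \<and>
            (\<forall>\<^sub>F t in nhds 0. snd g t = snd h (t / b) - a))"

(* The 1-moment as an equivalence class, i.e. the set of its representatives. *)
definition one_moment ::
    "(complex \<Rightarrow> complex) \<Rightarrow> ((complex \<Rightarrow> complex) \<times> (complex \<Rightarrow> complex)) set" where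
  "one_moment f = {g. \<exists>h. one_moment_pair f (fst h) (snd h) \<and> moment_equiv g h}"

end

theory Submission
  imports Defs
begin

text \<open>
  The germ f is sought among those analytically conjugate to the model u / (1 - u), which is
  w + 1 in the coordinate w = - 1 / u. Then f (z) = F (u / (1 - u)) with z = F (u), both sectorial
  trivializations are w, and the solutions of the 1-Abel equation are half sums of
  phi (w) = F (- 1 / w) along the orbits of w + 1, regularized. So the jump is the two-sided sum of
  phi (w + k) over all integers k, and the problem becomes linear: find phi analytic at infinity
  with prescribed sums in the half planes Im w > K and Im w < - K.

  For G (w) = g (exp (2 pi i w)) with g (0) = 0, the Cauchy integral C (w) of G over the segment
  from i K to i K + 1 is a solution: its translates add up to the Cauchy integral over the
  line Im = K, which is G (w) above the line and 0 below it. Since G has mean zero,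
  C (w) = O(1 / w^2), so that adding such terms to Ln (1 - 1 / w) keeps F tangent to the identity.

  The common asymptotic expansion of the half sums is the formal solution of the cohomological
  equation: its truncations solve the equation up to O(w^(-N)), and summation along an orbit
  loses only one power of w in sectors of opening less than 2 pi.
\<close>

section \<open>Power expansions and the formal cohomological equation\<close>

text \<open>Values of the germs at 0 are removed beforehand: a nonzero mean of \<open>G\<close>
  would give \<open>C\<close> a term of order 1 / w, which changes F'(0).
  \<open>moment_equiv\<close> adds one constant to the first germ and subtracts it from the second,
  and g_1(0) + g_2(0) = 0 says precisely that one such move clears both values. The order 1 / w is
  occupied by the leading term u = - 1 / w of F, whose one-sided sums diverge like a logarithm; the
  summand - log z of H is there to compensate. Ln (1 - 1 / w) is the form of the leading term for
  which the compensation is exact: it is the increment of a logarithm, and Ln (f z / z) produces the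
  same function at w + 1. Besides the terms built from \<open>C\<close>, only a coboundary vanishing
  at infinity is left, and two-sided sums do not see it. The second germ belongs to the lower ends
  of the orbit space; the reflection w -> - w brings it to the upper one.\<close>

lemma analytic_divide_id:
  fixes k :: "complex \<Rightarrow> complex"
  assumes "k analytic_on {0}" "k 0 = 0"
  shows "\<exists>k'. k' analytic_on {0} \<and> (\<forall>z. k z = z * k' z)"
proof -
  have "(\<lambda>z. if z = 0 then deriv k 0 else k z / z) analytic_on {0}"
    by (rule pole_theorem_analytic_0[OF assms(1), where a = 0])
       (use assms(2) in \<open>auto intro!: exI[of _ 1]\<close>)
  moreover have "\<forall>z. k z = z * (if z = 0 then deriv k 0 else k z / z)"
    using assms(2) by simp
  ultimately show ?thesis by blast
qed

lemma bigo_power_Suc_imp: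
  "h \<in> O[at (0::complex)](\<lambda>z. z ^ Suc n) \<Longrightarrow> h \<in> O[at 0](\<lambda>z. z ^ n)"
proof (erule landau_o.big_trans, rule bigoI[of _ 1])
  show "\<forall>\<^sub>F z in at (0::complex). norm (z ^ Suc n) \<le> 1 * norm (z ^ n)"
    by (rule eventually_mono[OF eventually_at_ball'[of 1 0 UNIV]])
       (auto simp: norm_mult intro!: mult_left_le_one_le)
qed

lemma bigo_power_mono:
  "m \<le> n \<Longrightarrow> h \<in> O[at (0::complex)](\<lambda>z. z ^ n) \<Longrightarrow> h \<in> O[at 0](\<lambda>z. z ^ m)"
  by (induction n rule: dec_induct) (auto simp del: power_Suc dest: bigo_power_Suc_imp)

lemma analytic_bigo_power_factor:
  fixes h :: "complex \<Rightarrow> complex"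
  assumes "h analytic_on {0}" "h \<in> O[at 0](\<lambda>z. z ^ n)"
  shows "\<exists>k. k analytic_on {0} \<and> (\<forall>\<^sub>F z in at 0. h z = z ^ n * k z)"
  using assms(2)
proof (induction n)
  case 0
  then show ?case using assms(1) by (intro exI[of _ h]) auto
next
  case (Suc n)
  then obtain k where k: "k analytic_on {0}" "\<forall>\<^sub>F z in at 0. h z = z ^ n * k z"
    using bigo_power_Suc_imp by blast
  obtain C where C: "C > 0" "\<forall>\<^sub>F z in at 0. norm (h z) \<le> C * norm (z ^ Suc n)"
    using Suc.prems by (elim landau_o.bigE)
  have "\<forall>\<^sub>F z in at (0::complex). z \<noteq> 0"
    by (auto simp: eventually_at intro!: exI[of _ 1])
  with C(2) k(2) have "\<forall>\<^sub>F z in at 0. norm (k z) \<le> C * norm z"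
    by eventually_elim (auto simp: norm_mult mult.assoc norm_power mult_ac)
  moreover have "((\<lambda>z::complex. C * norm z) \<longlongrightarrow> C * norm (0::complex)) (at 0)"
    by (rule tendsto_mult_left[OF tendsto_norm[OF tendsto_ident_at]])
  ultimately have "(k \<longlongrightarrow> 0) (at 0)"
    using Lim_null_comparison[of k "\<lambda>z. C * norm z" "at 0"] by simp
  moreover have "(k \<longlongrightarrow> k 0) (at 0)"
    using analytic_at_imp_isCont[OF k(1)] by (simp add: isCont_def)
  ultimately have "k 0 = 0"
    using tendsto_unique[of "at (0::complex)"] by force
  from analytic_divide_id[OF k(1) this] obtain k' where
    "k' analytic_on {0}" "\<And>z. k z = z * k' z" by blast
  with k(2) show ?case
    by (intro exI[of _ k']) (auto elim: eventually_mono)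
qed

lemma analytic_diff_const_bigo:
  fixes k :: "complex \<Rightarrow> complex"
  assumes "k analytic_on {0}"
  shows "(\<lambda>z. k z - k 0) \<in> O[at 0](\<lambda>z. z)"
proof -
  have "(\<lambda>z. k z - k 0) analytic_on {0}" using assms by (intro analytic_intros)
  from analytic_divide_id[OF this] obtain k' where
    k': "k' analytic_on {0}" "\<And>z. k z - k 0 = z * k' z" by auto
  have "k' \<in> O[at 0](\<lambda>_. 1)"
    using analytic_at_imp_isCont[OF k'(1)] by (intro bigoI_tendsto[of _ _ "k' 0"]) (auto simp: isCont_def)
  from landau_o.big.mult[OF landau_o.big_refl[of "\<lambda>z. z"] this]
  show ?thesis by (simp add: k'(2))
qed

lemma analytic_bigo_power_step:
  fixes h :: "complex \<Rightarrow> complex"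
  assumes "h analytic_on {0}" "h \<in> O[at 0](\<lambda>z. z ^ n)"
  shows "\<exists>c. (\<lambda>z. h z - c * z ^ n) \<in> O[at 0](\<lambda>z. z ^ Suc n)"
proof -
  obtain k where k: "k analytic_on {0}" "\<forall>\<^sub>F z in at 0. h z = z ^ n * k z"
    using analytic_bigo_power_factor[OF assms] by blast
  have "(\<lambda>z. (k z - k 0) * z ^ n) \<in> O[at 0](\<lambda>z. z * z ^ n)"
    by (intro landau_o.big.mult analytic_diff_const_bigo k) auto
  also have "?this \<longleftrightarrow> (\<lambda>z. h z - k 0 * z ^ n) \<in> O[at 0](\<lambda>z. z ^ Suc n)"
    unfolding power_Suc
    by (intro landau_o.big.in_cong)
       (use k(2) in \<open>auto elim!: eventually_mono simp: algebra_simps\<close>)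
  finally show ?thesis by blast
qed

text \<open>Each stage alters entry \<open>N\<close> only, so all later stages agree with it below
  \<open>N\<close>, and the diagonal sequence inherits every \<open>Q N\<close> through
  \<open>cong\<close>. It yields both Taylor coefficients and the formal solution below.\<close>

lemma coefficient_choice:
  fixes Q :: "nat \<Rightarrow> (nat \<Rightarrow> 'a) \<Rightarrow> bool"
  assumes cong: "\<And>N p q. (\<And>k. k < N \<Longrightarrow> p k = q k) \<Longrightarrow> Q N p \<Longrightarrow> Q N q"
  assumes base: "\<And>p. Q 0 p"
  assumes step: "\<And>N p. Q N p \<Longrightarrow> \<exists>c. Q (Suc N) (p(N := c))"
  shows "\<exists>a. \<forall>N. Q N a"
proof -
  have "\<exists>P. \<forall>N. Q N (P N) \<and> (\<exists>c. P (Suc N) = (P N)(N := c))"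
    by (rule dependent_nat_choice) (use base step in blast)+
  then obtain P where P: "\<And>N. Q N (P N)" "\<And>N. \<exists>c. P (Suc N) = (P N)(N := c)" by blast
  have "P (N + d) k = P N k" if "k < N" for N d k
  proof (induction d)
    case (Suc d)
    then show ?case using P(2)[of "N + d"] that by auto
  qed simp
  then have "P N k = P (Suc k) k" if "k < N" for N k
    using that by (metis Suc_leI le_add_diff_inverse lessI)
  then have "Q N (\<lambda>k. P (Suc k) k)" for N
    by (intro cong[OF _ P(1)[of N]])
  then show ?thesis by blast
qed

lemma analytic_asymptotic_expansion:
  fixes h :: "complex \<Rightarrow> complex"
  assumes "h analytic_on {0}"
  shows "\<exists>a :: nat \<Rightarrow> complex. \<forall>N. (\<lambda>z. h z - (\<Sum>k<N. a k * z ^ k)) \<in> O[at 0](\<lambda>z. z ^ N)"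
proof (rule coefficient_choice)
  fix N and p :: "nat \<Rightarrow> complex"
  assume *: "(\<lambda>z. h z - (\<Sum>k<N. p k * z ^ k)) \<in> O[at 0](\<lambda>z. z ^ N)"
  have "(\<lambda>z. h z - (\<Sum>k<N. p k * z ^ k)) analytic_on {0}"
    using assms by (intro analytic_intros)
  from analytic_bigo_power_step[OF this *] obtain c where
    "(\<lambda>z. h z - (\<Sum>k<N. p k * z ^ k) - c * z ^ N) \<in> O[at 0](\<lambda>z. z ^ Suc N)" by blast
  then show "\<exists>c. (\<lambda>z. h z - (\<Sum>k<Suc N. (p(N := c)) k * z ^ k)) \<in> O[at 0](\<lambda>z. z ^ Suc N)"
    by (intro exI[of _ c]) (simp add: algebra_simps)
next
  show "(\<lambda>z. h z - (\<Sum>k<0. p k * z ^ k)) \<in> O[at 0](\<lambda>z. z ^ 0)" for p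
    using analytic_at_imp_isCont[OF assms]
    by (auto intro!: bigoI_tendsto[of _ _ "h 0"] simp: isCont_def)
qed simp

section \<open>Formal solution of the cohomological equation of a parabolic germ\<close>

context
  fixes f :: "complex \<Rightarrow> complex"
  assumes f_an: "f analytic_on {0}"
  assumes f_exp: "(\<lambda>z. f z - z - z^2) \<in> O[at 0](\<lambda>z. z ^ 3)"
begin

lemma diff_id_bigo: "(\<lambda>z. f z - z) \<in> O[at 0](\<lambda>z. z ^ 2)"
proof -
  have "(\<lambda>z. (f z - z - z^2) + z^2) \<in> O[at 0](\<lambda>z. z ^ 2)"
    by (intro sum_in_bigo bigo_power_mono[OF _ f_exp]) auto
  then show ?thesis by simp
qed

lemma germ_bigo_id: "f \<in> O[at 0](\<lambda>z. z)"
proof -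
  have "(\<lambda>z. f z - z) \<in> O[at 0](\<lambda>z. z)"
    using bigo_power_mono[OF _ diff_id_bigo, of 1] by simp
  from sum_in_bigo(1)[OF this landau_o.big_refl] show ?thesis by simp
qed

text \<open>To leading order f is the flow of the vector field z^2 d/dz, which sends z^m to m
  z^(m+1).\<close>

lemma power_increment_bigo:
  "(\<lambda>z. f z ^ m - z ^ m - of_nat m * z ^ Suc m) \<in> O[at 0](\<lambda>z. z ^ (m + 2))"
proof (induction m)
  case (Suc m)
  have "(\<lambda>z. f z * (f z ^ m - z ^ m - of_nat m * z ^ Suc m) + (f z - z - z^2) * z ^ m
           + (f z - z) * (of_nat m * z ^ Suc m)) \<in> O[at 0](\<lambda>z. z ^ (Suc m + 2))"
  proof (intro sum_in_bigo)
    show "(\<lambda>z. f z * (f z ^ m - z ^ m - of_nat m * z ^ Suc m)) \<in> O[at 0](\<lambda>z. z ^ (Suc m + 2))"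
      using landau_o.big.mult[OF germ_bigo_id Suc.IH] by simp
    show "(\<lambda>z. (f z - z - z^2) * z ^ m) \<in> O[at 0](\<lambda>z. z ^ (Suc m + 2))"
      using landau_o.big.mult[OF f_exp landau_o.big_refl[of "\<lambda>z. z ^ m"]]
      by (simp only: power_add[symmetric]) (simp only: add.commute add_Suc_right numeral_eq_Suc pred_numeral_simps One_nat_def arith_simps add_Suc)
    have "(\<lambda>z. of_nat m * z ^ Suc m) \<in> O[at (0::complex)](\<lambda>z. z ^ Suc m)"
      by simp
    from landau_o.big.mult[OF diff_id_bigo this]
    show "(\<lambda>z. (f z - z) * (of_nat m * z ^ Suc m)) \<in> O[at 0](\<lambda>z. z ^ (Suc m + 2))"
      by (simp only: power_add[symmetric]) (simp only: add.commute)
  qed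
  also have "(\<lambda>z. f z * (f z ^ m - z ^ m - of_nat m * z ^ Suc m) + (f z - z - z^2) * z ^ m
           + (f z - z) * (of_nat m * z ^ Suc m)) =
      (\<lambda>z. f z ^ Suc m - z ^ Suc m - of_nat (Suc m) * z ^ Suc (Suc m))"
    by (simp add: algebra_simps power2_eq_square)
  finally show ?case .
qed simp

text \<open>The increment of z^(k+1) starts with (k + 1) z^(k+2). So at order N + 2 the only new
  contribution is (N + 1) \<open>a N\<close>, the coefficient is found by dividing by N + 1, and no
  obstruction arises once \<open>B\<close> vanishes to order 2. Leaving out the constant term
  selects the formal solution that vanishes at 0.\<close>

lemma formal_cohomological_equation:
  assumes "B analytic_on {0}" "B \<in> O[at 0](\<lambda>z. z ^ 2)" "f 0 = 0"
  shows "\<exists>a :: nat \<Rightarrow> complex. \<forall>N.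
           (\<lambda>z. (\<Sum>k<N. a k * (f z ^ Suc k - z ^ Suc k)) - B z) \<in> O[at 0](\<lambda>z. z ^ (N + 2))"
proof (rule coefficient_choice)
  show "(\<lambda>z. (\<Sum>k<0. p k * (f z ^ Suc k - z ^ Suc k)) - B z) \<in> O[at 0](\<lambda>z. z ^ (0 + 2))" for p
    using assms(2) by (simp add: numeral_2_eq_2 del: power_Suc)
next
  fix N and p :: "nat \<Rightarrow> complex"
  let ?e = "\<lambda>z. (\<Sum>k<N. p k * (f z ^ Suc k - z ^ Suc k)) - B z"
  assume *: "?e \<in> O[at 0](\<lambda>z. z ^ (N + 2))"
  have "?e analytic_on {0}"
    using assms f_an by (intro analytic_intros)
  have N3: "N + 3 = Suc (N + 2)" by simp
  obtain d where d: "(\<lambda>z. ?e z - d * z ^ (N + 2)) \<in> O[at 0](\<lambda>z. z ^ (N + 3))"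
    using analytic_bigo_power_step[OF \<open>?e analytic_on {0}\<close> *] unfolding N3 by blast
  define c where "c = - d / of_nat (Suc N)"
  have "(\<lambda>z. c * (f z ^ Suc N - z ^ Suc N - of_nat (Suc N) * z ^ Suc (Suc N)))
          \<in> O[at 0](\<lambda>z. z ^ (N + 3))"
    using power_increment_bigo[of "Suc N"] unfolding landau_o.big.cmult_in_iff' by (simp add: eval_nat_numeral)
  from sum_in_bigo(1)[OF d this]
  have "(\<lambda>z. (?e z - d * z ^ (N + 2)) +
      c * (f z ^ Suc N - z ^ Suc N - of_nat (Suc N) * z ^ Suc (Suc N))) \<in> O[at 0](\<lambda>z. z ^ (N + 3))" .
  moreover have "(?e z - d * z ^ (N + 2)) + c * (f z ^ Suc N - z ^ Suc N - of_nat (Suc N) * z ^ Suc (Suc N))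
    = ?e z + c * (f z ^ Suc N - z ^ Suc N)" for z
  proof -
    have "c * of_nat (Suc N) = - d" by (simp add: c_def del: of_nat_Suc)
    then have "c * (of_nat (Suc N) * z ^ Suc (Suc N)) = - d * z ^ (N + 2)"
      by (metis add_2_eq_Suc' mult.assoc)
    then show ?thesis by (simp only: right_diff_distrib) simp
  qed
  ultimately have "(\<lambda>z. ?e z + c * (f z ^ Suc N - z ^ Suc N)) \<in> O[at 0](\<lambda>z. z ^ (N + 3))"
    by (simp only:)
  moreover have "(\<lambda>z. (\<Sum>k<Suc N. (p(N := c)) k * (f z ^ Suc k - z ^ Suc k)) - B z)
      = (\<lambda>z. ?e z + c * (f z ^ Suc N - z ^ Suc N))"
    by (rule ext) (simp del: power_Suc)
  moreover have "Suc N + 2 = N + 3" by simp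
  ultimately show "\<exists>c. (\<lambda>z. (\<Sum>k<Suc N. (p(N := c)) k * (f z ^ Suc k - z ^ Suc k)) - B z)
            \<in> O[at 0](\<lambda>z. z ^ (Suc N + 2))"
    by metis
qed simp

end

section \<open>Sums along orbits of the unit translation\<close>

text \<open>Comparison of 1 / x^2 with the telescoping 1 / ((x - 1) x); the assumption on
  \<open>W\<close> turns 1 / (W - 1) into 2 / W.\<close>

lemma sum_inverse_square_shift_le:
  fixes W :: real
  assumes "W \<ge> 2"
  shows "(\<Sum>k<n. 1 / (W + real k) ^ 2) \<le> 2 / W"
proof -
  have "(\<Sum>k<n. 1 / (W + real k) ^ 2) \<le> 1 / (W - 1) - 1 / (W + real n - 1)"
  proof (induction n)
    case (Suc n)
    have "1 / (W + real n) ^ 2 \<le> 1 / ((W + real n - 1) * (W + real n))"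
      using assms unfolding power2_eq_square by (intro divide_left_mono mult_right_mono mult_pos_pos) auto
    also have "\<dots> = 1 / (W + real n - 1) - 1 / (W + real n)"
      using assms by (simp add: field_simps)
    finally show ?case using Suc.IH by (simp add: algebra_simps)
  qed (use assms in simp)
  also have "\<dots> \<le> 1 / (W - 1)" using assms by simp
  also have "\<dots> \<le> 2 / W" using assms by (simp add: field_simps)
  finally show ?thesis .
qed

text \<open>Off a cone around the direction opposite to the motion, an orbit cannot pass near 0. The
  law of cosines with cosine at least - \<kappa> leaves (1 - \<kappa>) (|w|^2 + t^2), which
  dominates (1 - \<kappa>) / 2 times (|w| + t)^2; squaring that factor as well only weakens the
  bound.\<close>

lemma norm_orbit_ge:
  fixes w :: complex and s \<kappa> t :: real
  assumes "\<bar>s\<bar> = 1" "0 \<le> \<kappa>" "\<kappa> < 1" "s * Re w \<ge> - \<kappa> * norm w" "t \<ge> 0"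
  shows "norm (w + of_real (s * t)) \<ge> (1 - \<kappa>) / 2 * (norm w + t)"
proof (rule power2_le_imp_le)
  have s2: "s * s = 1" using assms(1) by (metis abs_mult_self_eq mult.right_neutral)
  have "- \<kappa> * norm w * t \<le> s * Re w * t"
    using assms by (intro mult_right_mono) auto
  then have A: "- (\<kappa> * (norm w * t)) \<le> Re w * (s * t)" by (simp add: algebra_simps)
  have "(norm w + t)^2 \<le> 2 * (norm w ^ 2 + t ^ 2)"
    using sum_squares_bound[of "norm w" t] by (simp add: power2_eq_square algebra_simps)
  then have B: "(1 - \<kappa>) / 2 * (norm w + t)^2 \<le> (1 - \<kappa>) * (norm w ^ 2 + t ^ 2)"
    using assms mult_left_mono[of "(norm w + t)^2" "2 * (norm w ^ 2 + t ^ 2)" "(1 - \<kappa>) / 2"] by simp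
  have C: "\<kappa> * (2 * (norm w * t)) \<le> \<kappa> * (norm w ^ 2 + t ^ 2)"
    using assms sum_squares_bound[of "norm w" t] by (intro mult_left_mono) (auto simp: mult_ac)
  have "((1 - \<kappa>) / 2 * (norm w + t))^2 = (1 - \<kappa>) / 2 * ((1 - \<kappa>) / 2 * (norm w + t)^2)"
    by (simp add: power2_eq_square)
  also have "\<dots> \<le> 1 * ((1 - \<kappa>) / 2 * (norm w + t)^2)"
    using assms by (intro mult_right_mono) auto
  also have "\<dots> \<le> norm w ^ 2 + t ^ 2 - \<kappa> * (norm w ^ 2 + t ^ 2)"
    using B by (simp add: algebra_simps)
  also have "\<dots> \<le> norm w ^ 2 + t ^ 2 + 2 * (Re w * (s * t))"
    using A C by simp
  also have "\<dots> = (Re w + s * t)^2 + (Im w)^2"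
    using s2 by (simp add: cmod_power2 power2_sum power_mult_distrib power2_eq_square[of s])
  also have "\<dots> = norm (w + of_real (s * t)) ^ 2"
    by (simp add: cmod_power2)
  finally show "((1 - \<kappa>) / 2 * (norm w + t))^2 \<le> norm (w + of_real (s * t)) ^ 2" .
qed simp

text \<open>As \<rho> tends to 0 along the orbit, \<rho> w is minus the sum of its increments. Of
  the N + 2 powers in an increment, N are bounded through |w| alone, and the other two form an
  inverse-square sum of size 2 / |w|.\<close>

lemma telescoping_decay:
  fixes \<rho> :: "complex \<Rightarrow> complex" and s \<kappa> M W :: real
  assumes s: "\<bar>s\<bar> = 1" and \<kappa>: "0 \<le> \<kappa>" "\<kappa> < 1" and M: "0 \<le> M"
    and step: "\<And>w. w \<in> D \<Longrightarrow> w + of_real s \<in> D"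
    and inc: "\<And>w. w \<in> D \<Longrightarrow> norm w \<ge> W \<Longrightarrow> norm (\<rho> (w + of_real s) - \<rho> w) \<le> M / norm w ^ (N + 2)"
    and lim: "\<And>w. w \<in> D \<Longrightarrow> (\<lambda>n. \<rho> (w + of_real (s * real n))) \<longlonglongrightarrow> 0"
  shows "\<exists>C W'. 0 \<le> C \<and> (\<forall>w\<in>D. norm w \<ge> W' \<longrightarrow> s * Re w \<ge> - \<kappa> * norm w \<longrightarrow> norm (\<rho> w) \<le> C / norm w ^ (N + 1))"
proof -
  define c where "c = (1 - \<kappa>) / 2"
  have c: "c > 0" using \<kappa> by (simp add: c_def)
  define C where "C = M / c ^ (N + 2) * 2"
  \<comment> \<open>The threshold \<open>W / c\<close> keeps the whole orbit outside radius
    \<open>W\<close>, where \<open>inc\<close> applies; 2 is what the inverse-square sum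
    requires.\<close>
  have "norm (\<rho> w) \<le> C / norm w ^ (N + 1)"
    if w: "w \<in> D" "norm w \<ge> max 2 (W / c)" "s * Re w \<ge> - \<kappa> * norm w" for w
  proof -
    have w2: "norm w \<ge> 2" "norm w \<ge> W / c" using w by auto
    have wn: "w + of_real (s * real n) \<in> D" for n
    proof (induction n)
      case (Suc n)
      from step[OF this] show ?case by (simp add: algebra_simps)
    qed (use w in simp)
    have ge: "norm (w + of_real (s * real k)) \<ge> c * (norm w + real k)" for k
      unfolding c_def using norm_orbit_ge[OF s \<kappa> w(3), of "real k"] by simp
    have inc': "norm (\<rho> (w + of_real (s * real (Suc k))) - \<rho> (w + of_real (s * real k)))
          \<le> M / (c ^ (N + 2) * norm w ^ N) * (1 / (norm w + real k) ^ 2)" for k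
    proof -
      let ?u = "w + of_real (s * real k)"
      have "W \<le> c * norm w" using w2(2) c by (simp add: field_simps)
      also have "\<dots> \<le> c * (norm w + real k)" using c by simp
      finally have "norm ?u \<ge> W" using ge[of k] by linarith
      have cpos: "0 < c * (norm w + real k)" using c w2 by (intro mult_pos_pos) auto
      from inc[OF wn \<open>norm ?u \<ge> W\<close>]
      have "norm (\<rho> (?u + of_real s) - \<rho> ?u) \<le> M / norm ?u ^ (N + 2)" .
      also have "\<dots> \<le> M / (c * (norm w + real k)) ^ (N + 2)"
        using w2 c M cpos ge[of k] less_le_trans[OF cpos ge[of k]]
        by (intro divide_left_mono power_mono mult_pos_pos zero_less_power) simp_all
      also have "\<dots> = M / (c ^ (N + 2) * ((norm w + real k) ^ N * (norm w + real k) ^ 2))"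
        by (simp add: power_mult_distrib power_add power2_eq_square)
      also have "\<dots> \<le> M / (c ^ (N + 2) * (norm w ^ N * (norm w + real k) ^ 2))"
        using w2 c M
        by (intro divide_left_mono mult_left_mono mult_right_mono power_mono mult_pos_pos zero_less_power) auto
      finally show ?thesis by (simp add: algebra_simps)
    qed
    have bound: "norm (\<rho> (w + of_real (s * real n)) - \<rho> w) \<le> C / norm w ^ (N + 1)" for n
    proof -
      have "\<rho> (w + of_real (s * real n)) - \<rho> w
          = (\<Sum>k<n. \<rho> (w + of_real (s * real (Suc k))) - \<rho> (w + of_real (s * real k)))"
        by (subst sum_lessThan_telescope) simp
      also have "norm \<dots> \<le> (\<Sum>k<n. M / (c ^ (N + 2) * norm w ^ N) * (1 / (norm w + real k) ^ 2))"
        by (rule order_trans[OF norm_sum sum_mono[OF inc']])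
      also have "\<dots> = M / (c ^ (N + 2) * norm w ^ N) * (\<Sum>k<n. 1 / (norm w + real k) ^ 2)"
        by (simp add: sum_distrib_left)
      also have "\<dots> \<le> M / (c ^ (N + 2) * norm w ^ N) * (2 / norm w)"
        using M c by (intro mult_left_mono sum_inverse_square_shift_le w2) auto
      also have "\<dots> = C / norm w ^ (N + 1)"
        by (simp add: C_def)
      finally show ?thesis .
    qed
    have "(\<lambda>n. norm (\<rho> (w + of_real (s * real n)) - \<rho> w)) \<longlonglongrightarrow> norm (0 - \<rho> w)"
      by (intro tendsto_intros lim w)
    from tendsto_upperbound[OF this, of "C / norm w ^ (N + 1)"] bound
    show ?thesis by simp
  qed
  moreover have "C \<ge> 0" using M c by (simp add: C_def)
  ultimately show ?thesis by blast
qed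

text \<open>The sign \<open>s\<close> treats both petals at once: forward orbits for s = 1, backward
  orbits for s = - 1.\<close>

locale translation_orbit_sum =
  fixes b :: "complex \<Rightarrow> complex" and D :: "complex set" and s M :: real
  assumes s: "\<bar>s\<bar> = 1" and openD: "open D"
    and step: "\<And>w. w \<in> D \<Longrightarrow> w + of_real s \<in> D"
    and hol: "b holomorphic_on D"
    and bound: "\<And>w. w \<in> D \<Longrightarrow> norm (b w) \<le> M / norm w ^ 2"
begin

definition S :: "complex \<Rightarrow> complex" where
  "S w = (\<Sum>k. b (w + of_real (s * real k)))"

lemma orbit_in: "w \<in> D \<Longrightarrow> w + of_real (s * real n) \<in> D"
proof (induction n)
  case (Suc n)
  from step[OF Suc.IH[OF Suc.prems]] show ?case by (simp add: algebra_simps)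
qed simp

lemma uniform_bound:
  assumes "cball w d \<subseteq> D"
  shows "\<forall>\<^sub>F k in sequentially. \<forall>x\<in>cball w d. norm (b (x + of_real (s * real k))) \<le> \<bar>M\<bar> * 4 / real k ^ 2"
proof -
  have "\<forall>\<^sub>F k in sequentially. real k \<ge> max 1 (2 * (norm w + d))"
    using filterlim_real_sequentially unfolding filterlim_at_top by blast
  then show ?thesis
  proof eventually_elim
    case (elim k)
    show ?case
    proof
      fix x assume x: "x \<in> cball w d"
      have "norm x \<le> norm w + d"
        using x norm_triangle_ineq2[of x w] by (simp add: dist_norm norm_minus_commute)
      moreover have "real k \<le> norm (x + of_real (s * real k)) + norm x"
        using norm_triangle_ineq4[of "x + of_real (s * real k)" x] s by (simp add: norm_mult)
      moreover have "2 * (norm w + d) \<le> real k" "1 \<le> real k" using elim by auto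
      ultimately have ge: "norm (x + of_real (s * real k)) \<ge> real k / 2" by argo
      have "norm (b (x + of_real (s * real k))) \<le> M / norm (x + of_real (s * real k)) ^ 2"
        using bound orbit_in x assms by blast
      also have "\<dots> \<le> \<bar>M\<bar> / norm (x + of_real (s * real k)) ^ 2"
        by (intro divide_right_mono) auto
      also have "\<dots> \<le> \<bar>M\<bar> / (real k / 2) ^ 2"
        using ge elim by (intro divide_left_mono power_mono mult_pos_pos zero_less_power) auto
      finally show "norm (b (x + of_real (s * real k))) \<le> \<bar>M\<bar> * 4 / real k ^ 2"
        by (simp add: power_divide)
    qed
  qed
qed

lemma summable_bound: "summable (\<lambda>k. \<bar>M\<bar> * 4 / real k ^ 2)"
proof -
  have "summable (\<lambda>k. \<bar>M\<bar> * 4 * inverse (real k ^ 2))"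
    by (intro summable_mult inverse_power_summable) auto
  then show ?thesis by (simp add: divide_inverse)
qed

lemma summable_orbit:
  assumes "w \<in> D" shows "summable (\<lambda>k. b (w + of_real (s * real k)))"
proof (rule summable_comparison_test_ev[OF _ summable_bound])
  show "\<forall>\<^sub>F k in sequentially. norm (b (w + of_real (s * real k))) \<le> \<bar>M\<bar> * 4 / real k ^ 2"
    using uniform_bound[of w 0] assms by simp
qed

lemma S_holomorphic: "S holomorphic_on D"
proof (rule holomorphic_uniform_sequence[OF openD, where f = "\<lambda>n w. \<Sum>k<n. b (w + of_real (s * real k))"])
  show "(\<lambda>w. \<Sum>k<n. b (w + of_real (s * real k))) holomorphic_on D" for n
    by (intro holomorphic_intros holomorphic_on_compose_gen[OF _ hol, unfolded o_def])
       (use orbit_in in auto)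
next
  fix w assume "w \<in> D"
  then obtain d where d: "d > 0" "cball w d \<subseteq> D"
    using openD open_contains_cball by blast
  have "uniform_limit (cball w d) (\<lambda>n w. \<Sum>k<n. b (w + of_real (s * real k))) S sequentially"
    unfolding S_def
    by (rule Weierstrass_m_test_ev[OF uniform_bound[OF d(2)] summable_bound])
  with d show "\<exists>d>0. cball w d \<subseteq> D \<and>
      uniform_limit (cball w d) (\<lambda>n w. \<Sum>k<n. b (w + of_real (s * real k))) S sequentially" by blast
qed

lemma S_split:
  assumes "w \<in> D"
  shows "S w = (\<Sum>k<n. b (w + of_real (s * real k))) + S (w + of_real (s * real n))"
  using suminf_split_initial_segment[OF summable_orbit[OF assms], of n]
  by (simp add: S_def algebra_simps)

lemma S_step: "w \<in> D \<Longrightarrow> S w = b w + S (w + of_real s)"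
  using S_split[of w 1] by simp

lemma S_partial_sums:
  "w \<in> D \<Longrightarrow> (\<lambda>n. \<Sum>k<n. b (w + of_real (s * real k))) \<longlonglongrightarrow> S w"
  unfolding S_def by (intro summable_LIMSEQ summable_orbit)

lemma S_tail:
  assumes "w \<in> D"
  shows "(\<lambda>n. S (w + of_real (s * real n))) \<longlonglongrightarrow> 0"
proof -
  have "(\<lambda>n. S w - (\<Sum>k<n. b (w + of_real (s * real k)))) \<longlonglongrightarrow> S w - S w"
    by (intro tendsto_intros S_partial_sums assms)
  moreover have "S w - (\<Sum>k<n. b (w + of_real (s * real k))) = S (w + of_real (s * real n))" for n
    using S_split[OF assms, of n] by simp
  ultimately show ?thesis by simp
qed

end

section \<open>Cauchy integrals over one period\<close>

lemma contour_integral_linepath_shift: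
  "contour_integral (linepath (a + c) (b + c)) h = contour_integral (linepath a b) (\<lambda>\<zeta>. h (\<zeta> + c))"
proof -
  have "linepath (a + c) (b + c) x = linepath a b x + c" for x
    by (simp add: linepath_def algebra_simps)
  then show ?thesis by (simp add: contour_integral_integral)
qed

lemma contour_integral_rectpath:
  assumes "continuous_on (path_image (rectpath a1 a3)) h"
  defines "a2 \<equiv> Complex (Re a3) (Im a1)" and "a4 \<equiv> Complex (Re a1) (Im a3)"
  shows "contour_integral (rectpath a1 a3) h = contour_integral (linepath a1 a2) h +
    contour_integral (linepath a2 a3) h + contour_integral (linepath a3 a4) h + contour_integral (linepath a4 a1) h"
proof -
  have "path_image (rectpath a1 a3) = closed_segment a1 a2 \<union> closed_segment a2 a3 \<union> closed_segment a3 a4 \<union> closed_segment a4 a1"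
    by (auto simp: rectpath_def Let_def path_image_join a2_def a4_def)
  then have "continuous_on (closed_segment a1 a2) h" "continuous_on (closed_segment a2 a3) h"
     "continuous_on (closed_segment a3 a4) h" "continuous_on (closed_segment a4 a1) h"
    using assms(1) by (auto elim!: continuous_on_subset)
  then have "h contour_integrable_on (linepath a1 a2)" "h contour_integrable_on (linepath a2 a3)"
     "h contour_integrable_on (linepath a3 a4)" "h contour_integrable_on (linepath a4 a1)"
    by (auto intro: contour_integrable_continuous_linepath)
  then show ?thesis
    by (simp add: rectpath_def Let_def a2_def[symmetric] a4_def[symmetric] contour_integrable_joinI)
qed

text \<open>The disc of radius exp (- 2 pi K0) corresponds to the half-plane Im > K0. The strict
  inequality leaves a collar below the line Im = K, so that Cauchy's theorem applies to rectangles
  whose bottom side lies on that line.\<close>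

locale segment_transform =
  fixes g :: "complex \<Rightarrow> complex" and K0 K :: real
  assumes K0: "K0 < K" and hol: "g holomorphic_on ball 0 (exp (- 2 * pi * K0))" and g0: "g 0 = 0"
begin

definition G :: "complex \<Rightarrow> complex" where "G \<zeta> = g (exp (2 * pi * \<i> * \<zeta>))"

definition ends :: "real \<Rightarrow> complex" where "ends x = of_real x + \<i> * of_real K"

definition C :: "complex \<Rightarrow> complex" where
  "C w = contour_integral (linepath (ends 0) (ends 1)) (\<lambda>\<zeta>. G \<zeta> / (\<zeta> - w)) / (2 * pi * \<i>)"

\<comment> \<open>C (- 1 / u) = u * E u, which extends C analytically to w at infinity.\<close>
definition E :: "complex \<Rightarrow> complex" where
  "E u = contour_integral (linepath (ends 0) (ends 1)) (\<lambda>\<zeta>. G \<zeta> / (1 + u * \<zeta>)) / (2 * pi * \<i>)"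

lemma ends_simps [simp]: "Re (ends x) = x" "Im (ends x) = K"
  by (simp_all add: ends_def)

lemma norm_nome: "norm (exp (2 * pi * \<i> * \<zeta>)) = exp (- 2 * pi * Im \<zeta>)"
  by simp

lemma nome_in_ball: "Im \<zeta> > K0 \<Longrightarrow> exp (2 * pi * \<i> * \<zeta>) \<in> ball 0 (exp (- 2 * pi * K0))"
  using norm_nome[of \<zeta>] by simp

lemma G_holomorphic: "G holomorphic_on {\<zeta>. Im \<zeta> > K0}"
  unfolding G_def
  by (rule holomorphic_on_compose_gen[OF _ hol, unfolded o_def])
     (use nome_in_ball in \<open>auto intro!: holomorphic_intros\<close>)

lemma G_periodic: "G (\<zeta> + of_int m) = G \<zeta>"
proof -
  have "exp (2 * pi * \<i> * (\<zeta> + of_int m)) = exp (2 * pi * \<i> * \<zeta>) * exp (2 * of_int m * pi * \<i>)"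
    by (simp add: exp_add[symmetric] algebra_simps)
  also have "exp (2 * of_int m * pi * \<i>) = 1"
    using exp_integer_2pi[of "of_int m"] by (simp add: mult_ac)
  finally show ?thesis by (simp add: G_def)
qed

lemma quotient_by_id:
  obtains g' where "g' holomorphic_on ball 0 (exp (- 2 * pi * K0))" "\<And>t. g t = t * g' t"
proof
  show "(\<lambda>t. if t = 0 then deriv g 0 else g t / t) holomorphic_on ball 0 (exp (- 2 * pi * K0))"
    by (rule pole_theorem_open_0[OF hol, where a = 0]) (use g0 in auto)
qed (use g0 in auto)

lemma G_decay:
  obtains M where "M > 0" "\<And>\<zeta>. Im \<zeta> \<ge> K \<Longrightarrow> norm (G \<zeta>) \<le> M * exp (- 2 * pi * Im \<zeta>)"
proof -
  obtain g' where g': "g' holomorphic_on ball 0 (exp (- 2 * pi * K0))" "\<And>t. g t = t * g' t"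
    using quotient_by_id by blast
  have "cball 0 (exp (- 2 * pi * K)) \<subseteq> ball (0::complex) (exp (- 2 * pi * K0))"
    using K0 by (auto simp: subset_iff intro: le_less_trans)
  then have "continuous_on (cball 0 (exp (- 2 * pi * K))) g'"
    using g'(1) by (blast intro: continuous_on_subset holomorphic_on_imp_continuous_on)
  then have "bounded (g' ` cball 0 (exp (- 2 * pi * K)))"
    by (intro compact_imp_bounded compact_continuous_image) auto
  then obtain M where M: "M > 0" "\<And>t. t \<in> cball 0 (exp (- 2 * pi * K)) \<Longrightarrow> norm (g' t) \<le> M"
    unfolding bounded_pos by blast
  show thesis
  proof (rule that[OF M(1)])
    fix \<zeta> assume "Im \<zeta> \<ge> K"
    then have "exp (2 * pi * \<i> * \<zeta>) \<in> cball 0 (exp (- 2 * pi * K))"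
      using norm_nome[of \<zeta>] by simp
    from M(2)[OF this] show "norm (G \<zeta>) \<le> M * exp (- 2 * pi * Im \<zeta>)"
      using norm_nome[of \<zeta>] by (simp add: G_def g'(2) norm_mult mult.commute)
  qed
qed

lemma segment_Im: "\<zeta> \<in> closed_segment (ends x) (ends y) \<Longrightarrow> Im \<zeta> = K"
  by (simp add: closed_segment_same_Im)

lemma segment_norm: "\<zeta> \<in> closed_segment (ends 0) (ends 1) \<Longrightarrow> norm \<zeta> \<le> \<bar>K\<bar> + 1"
  using cmod_le[of \<zeta>] by (auto simp: closed_segment_same_Im closed_segment_eq_real_ivl)

text \<open>In the variable t = exp (2 pi i \<zeta>), the form G d\<zeta> becomes g' dt / (2 pi i),
  where \<open>g'\<close> is the quotient g / t and not the derivative. It is holomorphic because g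
  0 = 0, so it has a primitive on the disc, and both ends of the segment have the same t.\<close>

lemma G_mean_zero: "contour_integral (linepath (ends 0) (ends 1)) G = 0"
proof -
  obtain g' where g': "g' holomorphic_on ball 0 (exp (- 2 * pi * K0))" "\<And>t. g t = t * g' t"
    using quotient_by_id by blast
  obtain P where P: "\<And>t. t \<in> ball 0 (exp (- 2 * pi * K0)) \<Longrightarrow>
      (P has_field_derivative g' t) (at t within ball 0 (exp (- 2 * pi * K0)))"
    using holomorphic_convex_primitive'[OF convex_ball open_ball g'(1)] by blast
  have "((\<lambda>\<zeta>. P (exp (2 * pi * \<i> * \<zeta>)) / (2 * pi * \<i>)) has_field_derivative G \<zeta>) (at \<zeta> within {\<zeta>. Im \<zeta> > K0})"
    if "\<zeta> \<in> {\<zeta>. Im \<zeta> > K0}" for \<zeta>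
  proof -
    have "(P has_field_derivative g' (exp (2 * pi * \<i> * \<zeta>))) (at (exp (2 * pi * \<i> * \<zeta>)))"
      using P[OF nome_in_ball] that at_within_open[OF nome_in_ball open_ball] by auto
    moreover have "((\<lambda>\<zeta>. exp (2 * pi * \<i> * \<zeta>)) has_field_derivative exp (2 * pi * \<i> * \<zeta>) * (2 * pi * \<i>))
        (at \<zeta> within {\<zeta>. Im \<zeta> > K0})"
      by (auto intro!: derivative_eq_intros)
    ultimately have "((\<lambda>\<zeta>. P (exp (2 * pi * \<i> * \<zeta>)) / (2 * pi * \<i>)) has_field_derivative
        g' (exp (2 * pi * \<i> * \<zeta>)) * (exp (2 * pi * \<i> * \<zeta>) * (2 * pi * \<i>)) / (2 * pi * \<i>))
        (at \<zeta> within {\<zeta>. Im \<zeta> > K0})"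
      by (intro DERIV_cdivide DERIV_chain2[where f = P])
    then show ?thesis by (simp add: G_def g'(2) mult.commute)
  qed
  from contour_integral_primitive[OF this valid_path_linepath, of "ends 0" "ends 1"]
  have "(G has_contour_integral P (exp (2 * pi * \<i> * ends 1)) / (2 * pi * \<i>)
       - P (exp (2 * pi * \<i> * ends 0)) / (2 * pi * \<i>)) (linepath (ends 0) (ends 1))"
    using K0 segment_Im by fastforce
  moreover have "exp (2 * pi * \<i> * ends 1) = exp (2 * pi * \<i> * ends 0)"
  proof -
    have "2 * pi * \<i> * ends 1 = 2 * pi * \<i> * ends 0 + 2 * pi * \<i>"
      by (simp add: ends_def algebra_simps)
    then show ?thesis using exp_two_pi_i by (simp add: exp_add)
  qed
  ultimately show ?thesis by (simp add: contour_integral_unique)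
qed

lemma E_0: "E 0 = 0"
  using G_mean_zero by (simp add: E_def)

lemma C_conv_E: "u \<noteq> 0 \<Longrightarrow> C (- 1 / u) = u * E u"
proof -
  assume u: "u \<noteq> 0"
  have "(\<lambda>\<zeta>. G \<zeta> / (\<zeta> - (- 1 / u))) = (\<lambda>\<zeta>. u * (G \<zeta> / (1 + u * \<zeta>)))"
  proof
    fix \<zeta>
    have "\<zeta> - (- 1 / u) = (1 + u * \<zeta>) / u" using u by (simp add: field_simps)
    then show "G \<zeta> / (\<zeta> - (- 1 / u)) = u * (G \<zeta> / (1 + u * \<zeta>))" by simp
  qed
  moreover have "contour_integral (linepath (ends 0) (ends 1)) (\<lambda>\<zeta>. u * (G \<zeta> / (1 + u * \<zeta>)))
      = u * contour_integral (linepath (ends 0) (ends 1)) (\<lambda>\<zeta>. G \<zeta> / (1 + u * \<zeta>))"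
    unfolding contour_integral_integral mult.assoc by (rule integral_mult_right)
  ultimately show ?thesis unfolding C_def E_def by (simp only: times_divide_eq_right)
qed

text \<open>The segment lies in the disc of radius |K| + 1, so 1 + u \<zeta> has no zero there for
  such \<open>u\<close>, and one may differentiate under the integral.\<close>

lemma E_holomorphic: "E holomorphic_on ball 0 (1 / (\<bar>K\<bar> + 1))"
proof -
  let ?p = "linepath (ends 0) (ends 1)" and ?U = "ball 0 (1 / (\<bar>K\<bar> + 1)) :: complex set"
  have nz: "1 + u * ?p t \<noteq> 0" if "u \<in> ?U" "t \<in> {0..1}" for u t
  proof
    assume "1 + u * ?p t = 0"
    then have "norm (u * ?p t) = 1"
      by (metis add.commute eq_neg_iff_add_eq_0 norm_minus_cancel norm_one)
    moreover have "norm (?p t) \<le> \<bar>K\<bar> + 1"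
      using segment_norm that linepath_in_path by blast
    ultimately have "1 \<le> norm u * (\<bar>K\<bar> + 1)"
      by (metis mult_left_mono norm_ge_zero norm_mult)
    with that(1) show False by (simp add: field_simps)
  qed
  have "?p ` {0..1} \<subseteq> {\<zeta>. Im \<zeta> > K0}"
  proof clarify
    fix t :: real assume "t \<in> {0..1}"
    from segment_Im[OF linepath_in_path[OF this]] K0 show "K0 < Im (?p t)" by simp
  qed
  then have contG: "continuous_on {0..1} (\<lambda>t. G (?p t))"
    by (intro continuous_on_compose2[OF holomorphic_on_imp_continuous_on[OF G_holomorphic]]
        continuous_on_linepath)
  have "(\<lambda>u. integral (cbox 0 1) (\<lambda>t. G (?p t) / (1 + u * ?p t))) holomorphic_on ?U"
  proof (rule leibniz_rule_holomorphic)
    fix u t assume u: "u \<in> ?U" and t: "t \<in> cbox (0::real) 1"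
    show "((\<lambda>u. G (?p t) / (1 + u * ?p t)) has_field_derivative - G (?p t) * ?p t / (1 + u * ?p t)^2) (at u within ?U)"
      using nz[OF u] t by (auto intro!: derivative_eq_intros simp: power2_eq_square)
  next
    fix u assume u: "u \<in> ?U"
    show "(\<lambda>t. G (?p t) / (1 + u * ?p t)) integrable_on cbox 0 1"
      using nz[OF u] contG by (intro integrable_continuous continuous_intros) auto
  next
    have "continuous_on (?U \<times> {0..1}) (\<lambda>x. G (?p (snd x)))"
      by (rule continuous_on_compose2[OF contG]) (auto intro: continuous_intros)
    then show "continuous_on (?U \<times> cbox 0 1) (\<lambda>(u, t). - G (?p t) * ?p t / (1 + u * ?p t)^2)"
      using nz unfolding case_prod_beta
      by (intro continuous_intros) (auto simp: linepath_def intro!: continuous_intros)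
  qed auto
  then have "(\<lambda>u. integral (cbox 0 1) (\<lambda>t. G (?p t) / (1 + u * ?p t)) / (2 * pi * \<i>)) holomorphic_on ?U"
    by (intro holomorphic_intros) auto
  moreover have "E u = integral (cbox 0 1) (\<lambda>t. G (?p t) / (1 + u * ?p t)) / (2 * pi * \<i>)" for u
    by (simp add: E_def contour_integral_integral ends_def)
  ultimately show ?thesis by (simp cong: holomorphic_cong)
qed

section \<open>Two-sided sums as Cauchy integrals along a line\<close>

definition h :: "complex \<Rightarrow> complex \<Rightarrow> complex" where "h w \<zeta> = G \<zeta> / (\<zeta> - w)"

definition J :: "complex \<Rightarrow> real \<Rightarrow> real \<Rightarrow> complex" where
  "J w x y = contour_integral (linepath (ends x) (ends y)) (h w)"

lemma h_holomorphic: "h w holomorphic_on {\<zeta>. Im \<zeta> > K0} - {w}"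
  unfolding h_def by (intro holomorphic_intros holomorphic_on_subset[OF G_holomorphic]) auto

text \<open>Periodicity of \<open>G\<close> trades a shift of \<open>w\<close> for the opposite
  shift of the segment, so the translates of \<open>C\<close> become pieces of one Cauchy
  integral.\<close>

lemma C_shift: "C (w + of_int m) = J w (- of_int m) (1 - of_int m) / (2 * pi * \<i>)"
proof -
  have "ends (- of_int m) = ends 0 + of_int (- m)" "ends (1 - of_int m) = ends 1 + of_int (- m)"
    by (simp_all add: ends_def)
  then have "J w (- of_int m) (1 - of_int m) = contour_integral (linepath (ends 0) (ends 1)) (\<lambda>\<zeta>. h w (\<zeta> + of_int (- m)))"
    by (simp only: J_def contour_integral_linepath_shift)
  also have "(\<lambda>\<zeta>. h w (\<zeta> + of_int (- m))) = (\<lambda>\<zeta>. G \<zeta> / (\<zeta> - (w + of_int m)))"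
    unfolding h_def G_periodic by (simp add: algebra_simps)
  finally show ?thesis by (simp add: C_def)
qed

lemma J_combine:
  assumes "Im w \<noteq> K" "x \<le> y" "y \<le> z"
  shows "J w x z = J w x y + J w y z"
  unfolding J_def
proof (rule contour_integral_split_linepath)
  show "continuous_on (closed_segment (ends x) (ends z)) (h w)"
    by (rule continuous_on_subset[OF holomorphic_on_imp_continuous_on[OF h_holomorphic]])
       (use assms K0 segment_Im in fastforce)
  have "ends y \<in> {u. Im u = K \<and> Re u \<in> closed_segment x z}"
    using assms by (simp add: closed_segment_eq_real_ivl)
  then show "ends y \<in> closed_segment (ends x) (ends z)"
    by (simp add: closed_segment_same_Im)
qed

text \<open>The shifts - n, ..., n - 1 of \<open>w\<close> correspond to 2 n adjacent unit segments.
  Their union is centred at abscissa 1, since the unshifted segment runs from 0 to 1 and the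
  backward half has its first segment from 1 to 2.\<close>

lemma sum_C:
  assumes "Im w \<noteq> K"
  shows "(\<Sum>k<n. C (w + of_nat k)) + (\<Sum>k<n. C (w - 1 - of_nat k))
          = J w (1 - real n) (1 + real n) / (2 * pi * \<i>)"
proof (induction n)
  case 0
  then show ?case by (simp add: J_def)
next
  case (Suc n)
  have "C (w + of_nat n) = J w (- real n) (1 - real n) / (2 * pi * \<i>)"
    using C_shift[of w "int n"] by simp
  moreover have "C (w - 1 - of_nat n) = J w (1 + real n) (2 + real n) / (2 * pi * \<i>)"
    using C_shift[of w "- 1 - int n"] by (simp add: algebra_simps)
  moreover have "J w (- real n) (2 + real n) = J w (- real n) (1 - real n) + J w (1 - real n) (1 + real n)
      + J w (1 + real n) (2 + real n)"
    using J_combine[OF assms, of "- real n" "1 - real n" "2 + real n"]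
      J_combine[OF assms, of "1 - real n" "1 + real n" "2 + real n"] by simp
  moreover have "1 - real (Suc n) = - real n" "1 + real (Suc n) = 2 + real n" by simp_all
  ultimately show ?case
    using Suc.IH unfolding sum.lessThan_Suc by (simp only: add_divide_distrib) (simp add: algebra_simps)
qed

text \<open>The segment is closed up to a rectangle of half-width x^2 and height x, which encloses
  \<open>w\<close> exactly when Im w > K; the Cauchy integral formula then gives the main term. A
  vertical side has length x and distance at least x^2 / 2 from \<open>w\<close>, so it contributes
  2 / x; the top has length 2 x^2 and distance at least x / 2, but there \<open>G\<close> is smaller
  by the factor 1 / x^2, so it contributes 4 / x.\<close>

lemma norm_J_diff_le:
  assumes w: "Im w \<noteq> K" and M: "M > 0" "\<And>\<zeta>. Im \<zeta> \<ge> K \<Longrightarrow> norm (G \<zeta>) \<le> M * exp (- 2 * pi * Im \<zeta>)"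
    and x: "x \<ge> 1" "x \<ge> 2 * (\<bar>Im w\<bar> + \<bar>K\<bar>)" "x \<ge> 2 * (\<bar>Re w\<bar> + 2)"
  shows "norm (J w (1 - x^2) (1 + x^2) - (if Im w > K then 2 * pi * \<i> * G w else 0)) \<le> 8 * (M * exp (- 2 * pi * K)) / x"
proof -
  define M' where "M' = M * exp (- 2 * pi * K)"
  have M': "M' > 0" using M by (simp add: M'_def)
  define val where "val = (if Im w > K then 2 * pi * \<i> * G w else 0)"
  define a1 where "a1 = ends (1 - x^2)"
  define a3 where "a3 = Complex (1 + x^2) (K + x)"
  define a2 where "a2 = Complex (Re a3) (Im a1)"
  define a4 where "a4 = Complex (Re a1) (Im a3)"
  have xx: "x \<le> x^2" using x(1) by (simp add: power2_eq_square)
  have sub: "path_image (rectpath a1 a3) \<subseteq> {\<zeta>. Im \<zeta> \<ge> K} - {w}" if "Im w > K \<Longrightarrow> w \<in> box a1 a3"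
  proof -
    have "path_image (rectpath a1 a3) = cbox a1 a3 - box a1 a3"
      using x by (intro path_image_rectpath_cbox_minus_box) (auto simp: a1_def a3_def)
    then show ?thesis using that w by (auto simp: in_cbox_complex_iff a1_def)
  qed
  have inbox: "w \<in> box a1 a3" if "Im w > K"
    using that x xx by (auto simp: in_box_complex_iff a1_def a3_def)
  have int: "(h w has_contour_integral val) (rectpath a1 a3)"
  proof (cases "Im w > K")
    case True
    have "((\<lambda>\<zeta>. G \<zeta> / (\<zeta> - w)) has_contour_integral (2 * pi * \<i> * winding_number (rectpath a1 a3) w * G w)) (rectpath a1 a3)"
    proof (rule Cauchy_integral_formula_convex_simple[OF convex_halfspace_Im_gt G_holomorphic])
      show "w \<in> interior {\<zeta>. Im \<zeta> > K0}"
        using True K0 by (simp add: interior_open open_halfspace_Im_gt)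
      show "path_image (rectpath a1 a3) \<subseteq> {\<zeta>. Im \<zeta> > K0} - {w}"
        using sub inbox K0 by force
    qed auto
    then show ?thesis
      using winding_number_rectpath[OF inbox[OF True]] True by (simp add: val_def h_def[abs_def])
  next
    case False
    \<comment> \<open>Here \<open>w\<close> is below the line, and the half-plane in the rule
      contains the rectangle but not \<open>w\<close>.\<close>
    have "(h w has_contour_integral 0) (rectpath a1 a3)"
    proof (rule Cauchy_theorem_convex_simple[where S = "{\<zeta>. Im \<zeta> > max K0 (Im w)}"])
      show "h w holomorphic_on {\<zeta>. Im \<zeta> > max K0 (Im w)}"
        by (rule holomorphic_on_subset[OF h_holomorphic]) auto
      show "path_image (rectpath a1 a3) \<subseteq> {\<zeta>. Im \<zeta> > max K0 (Im w)}"
        using sub inbox K0 False w by force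
    qed (rule convex_halfspace_Im_gt valid_path_rectpath | simp)+
    then show ?thesis using False by (simp add: val_def)
  qed
  have cont: "continuous_on (path_image (rectpath a1 a3)) (h w)"
    by (rule continuous_on_subset[OF holomorphic_on_imp_continuous_on[OF h_holomorphic]])
       (use sub inbox K0 in force)
  have segs: "path_image (rectpath a1 a3) = closed_segment a1 a2 \<union> closed_segment a2 a3 \<union> closed_segment a3 a4 \<union> closed_segment a4 a1"
    by (auto simp: rectpath_def Let_def path_image_join a2_def a4_def)
  have "a2 = ends (1 + x^2)"
    by (simp add: a2_def a1_def a3_def complex_eq_iff)
  then have "J w (1 - x^2) (1 + x^2) = contour_integral (linepath a1 a2) (h w)"
    by (simp add: J_def a1_def)
  also have "\<dots> = val - (contour_integral (linepath a2 a3) (h w) +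
      contour_integral (linepath a3 a4) (h w) + contour_integral (linepath a4 a1) (h w))"
    using contour_integral_rectpath[OF cont] contour_integral_unique[OF int]
    by (simp add: a2_def a4_def algebra_simps)
  finally have eq: "J w (1 - x^2) (1 + x^2) - val = - (contour_integral (linepath a2 a3) (h w) +
      contour_integral (linepath a3 a4) (h w) + contour_integral (linepath a4 a1) (h w))" by simp
  have G_le: "norm (G \<zeta>) \<le> M'" if "Im \<zeta> \<ge> K" for \<zeta>
  proof -
    have "exp (- 2 * pi * Im \<zeta>) \<le> exp (- 2 * pi * K)" using that by simp
    from mult_left_mono[OF this, of M] M(2)[OF that] M(1) show ?thesis
      unfolding M'_def by linarith
  qed
  have vert: "norm (contour_integral (linepath a b) (h w)) \<le> M' / (x^2 / 2) * norm (b - a)"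
    if "closed_segment a b \<subseteq> path_image (rectpath a1 a3)"
       "\<And>\<zeta>. \<zeta> \<in> closed_segment a b \<Longrightarrow> x^2 / 2 \<le> norm (\<zeta> - w)" for a b
  proof (rule contour_integral_bound_linepath)
    show "h w contour_integrable_on linepath a b"
      using continuous_on_subset[OF cont that(1)] by (rule contour_integrable_continuous_linepath)
    fix \<zeta> assume \<zeta>: "\<zeta> \<in> closed_segment a b"
    then have "Im \<zeta> \<ge> K" using that(1) sub inbox by blast
    from G_le[OF this] show "norm (h w \<zeta>) \<le> M' / (x^2 / 2)"
      unfolding h_def norm_divide using that(2)[OF \<zeta>] x(1) M' by (intro frac_le) auto
  qed (use M' in simp)
  have "norm (contour_integral (linepath a2 a3) (h w)) \<le> M' / (x^2 / 2) * norm (a3 - a2)"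
  proof (rule vert)
    fix \<zeta> assume "\<zeta> \<in> closed_segment a2 a3"
    then have "Re \<zeta> = 1 + x^2" by (simp add: closed_segment_same_Re a2_def a3_def)
    then show "x^2 / 2 \<le> norm (\<zeta> - w)"
      using abs_Re_le_cmod[of "\<zeta> - w"] x xx by simp
  qed (use segs in auto)
  also have "a3 - a2 = \<i> * of_real x" by (simp add: complex_eq_iff a3_def a2_def a1_def)
  also have "M' / (x^2 / 2) * norm (\<i> * of_real x) = 2 * M' / x"
    using x(1) by (simp add: norm_mult power2_eq_square)
  finally have right: "norm (contour_integral (linepath a2 a3) (h w)) \<le> 2 * M' / x" .
  have "norm (contour_integral (linepath a4 a1) (h w)) \<le> M' / (x^2 / 2) * norm (a1 - a4)"
  proof (rule vert)
    fix \<zeta> assume "\<zeta> \<in> closed_segment a4 a1"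
    then have "Re \<zeta> = 1 - x^2" by (simp add: closed_segment_same_Re a4_def a1_def)
    then show "x^2 / 2 \<le> norm (\<zeta> - w)"
      using abs_Re_le_cmod[of "\<zeta> - w"] x xx by simp
  qed (use segs in auto)
  also have "a1 - a4 = - \<i> * of_real x" by (simp add: complex_eq_iff a3_def a4_def a1_def)
  also have "M' / (x^2 / 2) * norm (- \<i> * of_real x) = 2 * M' / x"
    using x(1) by (simp add: norm_mult power2_eq_square)
  finally have left: "norm (contour_integral (linepath a4 a1) (h w)) \<le> 2 * M' / x" .
  have "norm (contour_integral (linepath a3 a4) (h w)) \<le> M' * (1 / x^2) / (x / 2) * norm (a4 - a3)"
  proof (rule contour_integral_bound_linepath)
    show "h w contour_integrable_on linepath a3 a4"
      by (rule contour_integrable_continuous_linepath, rule continuous_on_subset[OF cont]) (use segs in auto)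
    fix \<zeta> assume "\<zeta> \<in> closed_segment a3 a4"
    then have Im: "Im \<zeta> = K + x" by (simp add: closed_segment_same_Im a3_def a4_def)
    \<comment> \<open>The exponential decay of \<open>G\<close> is used only as 1 / x^2, which
      offsets the length of the top side.\<close>
    have "x^2 \<le> exp (2 * pi * x)"
    proof -
      have "x^2 \<le> (2 * pi * x)^2 / 2"
      proof -
        have "1 \<le> pi^2" using pi_ge_two by (intro one_le_power) linarith
        then have "1 * x^2 \<le> (2 * pi^2) * x^2"
          by (intro mult_right_mono) auto
        then show ?thesis by (simp add: power_mult_distrib)
      qed
      also have "\<dots> \<le> exp (2 * pi * x)"
        using exp_lower_Taylor_quadratic[of "2 * pi * x"] x(1)
        by (smt (verit) mult_nonneg_nonneg pi_ge_zero)
      finally show ?thesis .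
    qed
    then have "exp (- 2 * pi * x) \<le> 1 / x^2"
      using x(1) by (simp add: exp_minus field_simps)
    then have "M' * exp (- 2 * pi * x) \<le> M' * (1 / x^2)"
      using M' by (intro mult_left_mono) auto
    moreover have "norm (G \<zeta>) \<le> M' * exp (- 2 * pi * x)"
      using M(2)[of \<zeta>] Im x(1) by (simp add: M'_def exp_add[symmetric] algebra_simps)
    ultimately have "norm (G \<zeta>) \<le> M' * (1 / x^2)" by linarith
    moreover have "x / 2 \<le> norm (\<zeta> - w)"
      using abs_Im_le_cmod[of "\<zeta> - w"] x Im by simp
    ultimately show "norm (h w \<zeta>) \<le> M' * (1 / x^2) / (x / 2)"
      unfolding h_def norm_divide using x(1) M' by (intro frac_le) auto
  qed (use M' x in simp)
  also have "a4 - a3 = of_real (- 2 * x^2)" by (simp add: complex_eq_iff a3_def a4_def a1_def)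
  also have "M' * (1 / x^2) / (x / 2) * norm (of_real (- 2 * x^2) :: complex) = 4 * M' / x"
    using x(1) by (simp only: norm_of_real) (simp add: power2_eq_square)
  finally have top: "norm (contour_integral (linepath a3 a4) (h w)) \<le> 4 * M' / x" .
  have "norm (J w (1 - x^2) (1 + x^2) - val) \<le> 2 * M' / x + 4 * M' / x + 2 * M' / x"
    unfolding eq norm_minus_cancel
    by (intro order_trans[OF norm_triangle_ineq] add_mono left right top)
  then show ?thesis by (simp add: val_def M'_def add_divide_distrib)
qed

lemma two_sided_sum_C:
  assumes "Im w \<noteq> K"
  shows "(\<lambda>n. (\<Sum>k<n. C (w + of_nat k)) + (\<Sum>k<n. C (w - 1 - of_nat k)))
           \<longlonglongrightarrow> (if Im w > K then G w else 0)"
proof -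
  let ?val = "if Im w > K then 2 * pi * \<i> * G w else 0"
  obtain M where M: "M > 0" "\<And>\<zeta>. Im \<zeta> \<ge> K \<Longrightarrow> norm (G \<zeta>) \<le> M * exp (- 2 * pi * Im \<zeta>)"
    using G_decay by blast
  \<comment> \<open>The rectangle estimate is applied with x = sqrt n, so that the half-width x^2 is
    n.\<close>
  have lim: "filterlim (\<lambda>n. sqrt (real n)) at_top sequentially"
    by (rule filterlim_compose[OF sqrt_at_top filterlim_real_sequentially])
  have "(\<lambda>n. J w (1 - real n) (1 + real n) - ?val) \<longlonglongrightarrow> 0"
  proof (rule Lim_null_comparison)
    have "\<forall>\<^sub>F n in sequentially. sqrt (real n) \<ge> max 1 (max (2 * (\<bar>Im w\<bar> + \<bar>K\<bar>)) (2 * (\<bar>Re w\<bar> + 2)))"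
      using lim unfolding filterlim_at_top by blast
    then show "\<forall>\<^sub>F n in sequentially. norm (J w (1 - real n) (1 + real n) - ?val)
        \<le> 8 * (M * exp (- 2 * pi * K)) / sqrt (real n)"
    proof eventually_elim
      case (elim n)
      then have "sqrt (real n) \<ge> 1" "sqrt (real n) \<ge> 2 * (\<bar>Im w\<bar> + \<bar>K\<bar>)"
        "sqrt (real n) \<ge> 2 * (\<bar>Re w\<bar> + 2)"
        by (simp_all only: max.bounded_iff)
      from norm_J_diff_le[OF assms M this] show ?case by (simp only: real_sqrt_pow2 of_nat_0_le_iff)
    qed
    show "(\<lambda>n. 8 * (M * exp (- 2 * pi * K)) / sqrt (real n)) \<longlonglongrightarrow> 0"
      by (rule tendsto_divide_0[OF tendsto_const filterlim_at_top_imp_at_infinity[OF lim]])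
  qed
  then have "(\<lambda>n. J w (1 - real n) (1 + real n)) \<longlonglongrightarrow> ?val"
    by (simp only: LIM_zero_iff)
  then have "(\<lambda>n. J w (1 - real n) (1 + real n) / (2 * pi * \<i>)) \<longlonglongrightarrow> ?val / (2 * pi * \<i>)"
    by (intro tendsto_divide) auto
  moreover have "?val / (2 * pi * \<i>) = (if Im w > K then G w else 0)" by simp
  ultimately show ?thesis unfolding sum_C[OF assms] by (simp only:)
qed

end

section \<open>Germs conjugate to the model\<close>

definition model :: "complex \<Rightarrow> complex" where "model u = u / (1 - u)"

text \<open>
  Petals are the images of these parabolic regions, with s = 1 for the attracting and s = -1 for
  the repelling one. Unlike sectors, they contain at infinity all sectors of opening less than 2 pi,
  while cusp R 1 and cusp R (-1) only meet where |Im w| > R.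
\<close>

definition cusp :: "real \<Rightarrow> real \<Rightarrow> complex set" where
  "cusp R s = {w. s * Re w + (Im w)^2 > 2 * R^2}"

section \<open>Geometry of the parabolic regions\<close>

lemma open_cusp: "open (cusp R s)"
  unfolding cusp_def by (intro open_Collect_less continuous_intros)

text \<open>On the disc of radius R the defining expression is at most R + R^2, and the threshold 2
  R^2 is chosen to dominate this.\<close>

lemma norm_cusp_gt:
  assumes "\<bar>s\<bar> = 1" "R \<ge> 1" "w \<in> cusp R s"
  shows "norm w > R"
proof (rule ccontr)
  assume "\<not> norm w > R"
  then have *: "\<bar>Re w\<bar> \<le> R" "\<bar>Im w\<bar> \<le> R"
    using abs_Re_le_cmod[of w] abs_Im_le_cmod[of w] by linarith+
  have "s * Re w \<le> \<bar>s * Re w\<bar>" by simp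
  then have "s * Re w \<le> R" using * assms by (simp add: abs_mult)
  moreover have "(Im w)^2 \<le> R^2" using * by (simp add: abs_le_square_iff[symmetric])
  moreover have "R \<le> R^2" using assms by (simp add: power2_eq_square)
  ultimately show False using assms(3) by (simp add: cusp_def)
qed

text \<open>Adding the two defining inequalities cancels Re w.\<close>

lemma Im_cusp_Int:
  assumes "R \<ge> 0" "w \<in> cusp R 1" "w \<in> cusp R (-1)"
  shows "\<bar>Im w\<bar> > R"
proof -
  have "R^2 < (Im w)^2" using assms(2,3) by (auto simp: cusp_def) (smt (verit) zero_le_power2)
  then show ?thesis using assms(1) by (metis abs_ge_zero power2_abs power2_less_imp_less)
qed

lemma cusp_step: "s * s = 1 \<Longrightarrow> w \<in> cusp R s \<Longrightarrow> w + of_real s \<in> cusp R s"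
  by (simp add: cusp_def algebra_simps)

lemma cusp_orbit: "s * s = 1 \<Longrightarrow> w \<in> cusp R s \<Longrightarrow> w + of_real (s * real n) \<in> cusp R s"
proof (induction n)
  case (Suc n)
  from cusp_step[OF Suc.prems(1) Suc.IH[OF Suc.prems]] show ?case by (simp add: algebra_simps)
qed simp

text \<open>A shear straightens the bounding parabola and carries the region onto a
  half-plane.\<close>

lemma simply_connected_cusp:
  assumes s: "s * s = 1" shows "simply_connected (cusp R s)"
proof -
  have ss: "s * (s * x) = x" for x using s by (metis mult.assoc mult_1)
  let ?H = "{w. Re w > 2 * R^2}"
  have "homeomorphism (cusp R s) ?H (\<lambda>w. Complex (s * Re w + (Im w)^2) (Im w))
      (\<lambda>w. Complex (s * (Re w - (Im w)^2)) (Im w))"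
  proof (rule homeomorphismI)
    show "continuous_on (cusp R s) (\<lambda>w. Complex (s * Re w + (Im w)^2) (Im w))"
         "continuous_on ?H (\<lambda>w. Complex (s * (Re w - (Im w)^2)) (Im w))"
      unfolding Complex_eq by (intro continuous_intros)+
  qed (auto simp: cusp_def complex_eq_iff ss algebra_simps)
  then have "cusp R s homeomorphic ?H" unfolding homeomorphic_def by blast
  moreover have "simply_connected ?H"
    by (intro convex_imp_simply_connected convex_halfspace_Re_gt)
  ultimately show ?thesis using homeomorphic_simply_connected_eq by blast
qed

text \<open>If s Re w is at least \<kappa> |w|, the linear term alone exceeds the threshold.
  Otherwise |Re w| is at most \<kappa> |w|, so (Im w)^2 grows quadratically and beats the possibly
  negative linear term. The two quotients in \<open>W\<close> serve these two cases.\<close>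

lemma sector_in_cusp:
  assumes s: "\<bar>s\<bar> = 1" and \<kappa>: "0 < \<kappa>" "\<kappa> < 1"
  shows "\<exists>W>0. \<forall>w. norm w \<ge> W \<longrightarrow> s * Re w \<ge> - \<kappa> * norm w \<longrightarrow> w \<in> cusp R s"
proof -
  define W where "W = max 1 (max ((2 * R^2 + 1) / \<kappa>) ((2 * R^2 + 2) / (1 - \<kappa>^2)))"
  have \<kappa>2: "\<kappa>^2 < 1" using \<kappa> by (simp add: power_less_one_iff)
  have "w \<in> cusp R s" if w: "norm w \<ge> W" "s * Re w \<ge> - \<kappa> * norm w" for w
  proof (cases "s * Re w \<ge> \<kappa> * norm w")
    case True
    have "norm w \<ge> (2 * R^2 + 1) / \<kappa>" using w(1) by (simp add: W_def)
    then have "\<kappa> * norm w \<ge> 2 * R^2 + 1" using \<kappa> by (simp add: field_simps)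
    then have "s * Re w + (Im w)^2 \<ge> 2 * R^2 + 1"
      using True zero_le_power2[of "Im w"] by linarith
    then show ?thesis by (simp add: cusp_def)
  next
    case False
    have "\<bar>Re w\<bar> = \<bar>s * Re w\<bar>" using s by (simp add: abs_mult)
    also have "\<dots> \<le> \<kappa> * norm w" using False w(2) by linarith
    finally have "(Re w)^2 \<le> (\<kappa> * norm w)^2" using \<kappa> by (simp add: abs_le_square_iff[symmetric])
    then have Im: "(Im w)^2 \<ge> (1 - \<kappa>^2) * norm w ^ 2"
      using cmod_power2[of w] by (simp add: power_mult_distrib algebra_simps)
    have n1: "norm w \<ge> 1" "norm w \<ge> (2 * R^2 + 2) / (1 - \<kappa>^2)" using w(1) by (simp_all add: W_def)
    then have "(1 - \<kappa>^2) * norm w \<ge> 2 * R^2 + 2" using \<kappa>2 by (simp add: field_simps)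
    then have "norm w * ((1 - \<kappa>^2) * norm w) \<ge> norm w * (2 * R^2 + 2)"
      using n1 by (intro mult_left_mono) auto
    moreover have "norm w * (2 * R^2 + 1) \<ge> 1 * (2 * R^2 + 1)"
      using n1 by (intro mult_right_mono) auto
    moreover have "s * Re w \<ge> - norm w"
      using w(2) \<kappa> mult_right_mono[of \<kappa> 1 "norm w"] by simp
    ultimately have "s * Re w + (Im w)^2 > 2 * R^2"
      using Im by (simp add: power2_eq_square algebra_simps)
    then show ?thesis by (simp add: cusp_def)
  qed
  moreover have "W > 0" by (simp add: W_def)
  ultimately show ?thesis by blast
qed

lemma Re_ge_of_sector:
  assumes "z \<in> sector v \<delta>" "0 < \<delta>" "\<delta> < pi" "norm v = 1"
  shows "Re (z / v) \<ge> cos \<delta> * norm z"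
proof -
  have "z / v \<noteq> 0" using assms by (auto simp: sector_def)
  then have "Re (z / v) = norm (z / v) * cos (Arg (z / v))"
    by (simp add: cos_Arg)
  also have "cos (Arg (z / v)) = cos \<bar>Arg (z / v)\<bar>" by simp
  also have "norm (z / v) * cos \<bar>Arg (z / v)\<bar> \<ge> norm (z / v) * cos \<delta>"
    using assms by (intro mult_left_mono cos_monotone_0_pi_le) (auto simp: sector_def)
  finally show ?thesis using assms by (simp add: norm_divide mult.commute)
qed

section \<open>The conjugated germ and its petals\<close>

locale model_conjugacy =
  fixes F Fi :: "complex \<Rightarrow> complex" and r A :: real
  assumes r: "0 < r" "r \<le> 1" and F_hol: "F holomorphic_on ball 0 r"
    and Fi_F: "\<And>u. u \<in> ball 0 r \<Longrightarrow> Fi (F u) = u"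
    and Fi_hol: "Fi holomorphic_on F ` ball 0 r"
    and F_close: "\<And>u. u \<in> ball 0 r \<Longrightarrow> norm (F u - u) \<le> A * norm u ^ 2"
    and A: "0 \<le> A" "A * r \<le> 1 / 4"
begin

definition f :: "complex \<Rightarrow> complex" where "f z = F (model (Fi z))"

text \<open>The parametrization of a punctured neighbourhood of 0 by w near infinity, under which
  \<open>f\<close> becomes the unit translation; its inverse is - 1 / \<open>Fi\<close>.\<close>

definition Z :: "complex \<Rightarrow> complex" where "Z w = F (- 1 / w)"

lemma F_0: "F 0 = 0" using F_close[of 0] r by simp

lemma Fi_0: "Fi 0 = 0" using Fi_F[of 0] F_0 r by simp

lemma inj_F: "inj_on F (ball 0 r)"
  by (rule inj_on_inverseI[of _ Fi]) (rule Fi_F)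

lemma F_eq_0_iff: "u \<in> ball 0 r \<Longrightarrow> F u = 0 \<longleftrightarrow> u = 0"
  using Fi_F[of u] Fi_0 F_0 by metis

text \<open>The purpose of the assumption A r \<le> 1 / 4: F changes moduli by at most a factor 2,
  so |Z w| and 1 / |w| are comparable.\<close>

lemma norm_F_diff: assumes "u \<in> ball 0 r" shows "norm (F u - u) \<le> norm u / 4"
proof -
  have "norm (F u - u) \<le> (A * norm u) * norm u"
    using F_close[OF assms] by (simp add: power2_eq_square mult.assoc)
  also have "\<dots> \<le> (A * r) * norm u"
    using assms A by (intro mult_right_mono mult_left_mono) auto
  also have "\<dots> \<le> 1 / 4 * norm u" using A by (intro mult_right_mono) auto
  finally show ?thesis by simp
qed

lemma norm_F_bounds:
  assumes "u \<in> ball 0 r" shows "norm (F u) \<le> 2 * norm u" "norm u \<le> 2 * norm (F u)"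
  using norm_F_diff[OF assms] norm_triangle_ineq2[of "F u" u] norm_triangle_ineq3[of u "F u"]
    norm_minus_commute[of u "F u"] norm_ge_zero[of u] by linarith+

lemma open_F_image:
  assumes "open T" "T \<subseteq> ball 0 r" shows "open (F ` T)"
  by (rule open_mapping_thm3[OF holomorphic_on_subset[OF F_hol assms(2)] assms(1) inj_on_subset[OF inj_F assms(2)]])

lemma inv_in_ball:
  fixes w :: complex
  assumes w: "norm w > 1 / r" shows "- 1 / w \<in> ball 0 r"
proof -
  have "0 < 1 / r" using r by simp
  with w have "0 < norm w" by linarith
  then show ?thesis using w r by (simp add: norm_divide field_simps)
qed

lemma Fi_Z: "norm w > 1 / r \<Longrightarrow> Fi (Z w) = - 1 / w"
  unfolding Z_def by (intro Fi_F inv_in_ball)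

lemma Z_nonzero: assumes "norm w > 1 / r" shows "Z w \<noteq> 0"
proof -
  have "w \<noteq> 0" using assms r by auto
  then show ?thesis unfolding Z_def using F_eq_0_iff inv_in_ball[OF assms] by simp
qed

lemma Z_bounds: 
  assumes "norm w > 1 / r" shows "norm (Z w) \<le> 2 / norm w" "1 / norm w \<le> 2 * norm (Z w)"
  unfolding Z_def using norm_F_bounds[OF inv_in_ball[OF assms]] by (simp_all add: norm_divide)

lemma Z_holomorphic: "Z holomorphic_on {w. norm w > 1 / r}"
  unfolding Z_def
proof (rule holomorphic_on_compose_gen[OF _ F_hol, unfolded o_def])
  show "(\<lambda>w. - 1 / w) holomorphic_on {w. norm w > 1 / r}"
    using r by (intro holomorphic_intros) auto
qed (use inv_in_ball in blast)

lemma Z_tendsto: "(Z \<longlongrightarrow> 0) at_infinity"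
proof (rule Lim_null_comparison)
  show "\<forall>\<^sub>F w in at_infinity. norm (Z w) \<le> 2 / norm w"
    using Z_bounds(1) unfolding eventually_at_infinity
    by (intro exI[of _ "1 / r + 1"]) auto
  show "((\<lambda>w::complex. 2 / norm w) \<longlongrightarrow> 0) at_infinity"
    by (rule tendsto_divide_0[OF tendsto_const]) (rule filterlim_at_top_imp_at_infinity[OF filterlim_norm_at_top])
qed

lemma orbit_at_infinity:
  assumes "\<bar>s\<bar> = 1" shows "filterlim (\<lambda>n. w + of_real (s * real n) :: complex) at_infinity sequentially"
proof -
  have lower: "filterlim (\<lambda>n. - norm w + real n) at_top sequentially"
    by (rule filterlim_tendsto_add_at_top[OF tendsto_const filterlim_real_sequentially])
  have le: "- norm w + real n \<le> norm (w + of_real (s * real n))" for n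
    using norm_triangle_ineq4[of "w + of_real (s * real n)" w] assms by (simp add: norm_mult)
  from filterlim_at_top_mono[OF lower always_eventually[OF allI[OF le]]]
  show ?thesis by (rule filterlim_norm_at_top_imp_at_infinity)
qed

lemma f_Z: assumes "norm w > 1 / r" shows "f (Z w) = Z (w + 1)"
proof -
  have w: "w \<noteq> 0" using assms r by auto
  then have "1 - (- 1 / w) = (w + 1) / w" by (simp add: field_simps)
  then have "model (- 1 / w) = - 1 / (w + 1)" using w by (simp add: model_def)
  then show ?thesis by (simp add: f_def Fi_Z[OF assms]) (simp add: Z_def)
qed


lemma Zi_Z: "norm w > 1 / r \<Longrightarrow> - 1 / Fi (Z w) = w"
  by (simp add: Fi_Z)

lemma inj_Z: "inj_on Z {w. norm w > 1 / r}"
  by (rule inj_on_inverseI[of _ "\<lambda>z. - 1 / Fi z"]) (use Zi_Z in simp)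

lemma Zi_holomorphic: "(\<lambda>z. - 1 / Fi z) holomorphic_on F ` ball 0 r - {0}"
proof -
  have "Fi holomorphic_on F ` ball 0 r - {0}"
    by (rule holomorphic_on_subset[OF Fi_hol]) auto
  moreover have "Fi z \<noteq> 0" if "z \<in> F ` ball 0 r - {0}" for z
    using that Fi_F F_0 by auto
  ultimately show ?thesis by (intro holomorphic_intros)
qed

lemma Z_image:
  assumes "T \<subseteq> {w. norm w > 1 / r}" shows "Z ` T \<subseteq> F ` ball 0 r - {0}"
proof clarify
  fix w assume "w \<in> T"
  then have w: "norm w > 1 / r" using assms by blast
  show "Z w \<in> F ` ball 0 r - {0}"
    using Z_nonzero[OF w] imageI[OF inv_in_ball[OF w], of F] unfolding Z_def by simp
qed

lemma Z_in_half: assumes "norm w > 2 / r" shows "Z w \<in> F ` ball 0 (r / 2)"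
proof -
  have "0 < 2 / r" using r by simp
  with assms have "0 < norm w" by linarith
  then have "- 1 / w \<in> ball 0 (r / 2)" using assms r by (simp add: norm_divide field_simps)
  then show ?thesis unfolding Z_def by blast
qed

lemma Z_tendsto_orbit: "\<bar>s\<bar> = 1 \<Longrightarrow> (\<lambda>n. Z (w + of_real (s * real n))) \<longlonglongrightarrow> 0"
  by (rule filterlim_compose[OF Z_tendsto orbit_at_infinity])

text \<open>The map u -> - 1 / u turns the sector around - s into a cone around s. F tilts
  directions by an amount of order |u|, so the cone must be slightly wider than |cos \<delta>| =: q
  prescribes: \<kappa> lies midway between q and 1, and \<rho> makes the error 2 A |u| fit into the
  margin (1 - q) / 2.\<close>

lemma sector_orbit_coordinate:
  assumes s: "\<bar>s\<bar> = 1" and \<delta>: "0 < \<delta>" "\<delta> < pi"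
  shows "\<exists>\<kappa> \<rho>. 0 < \<kappa> \<and> \<kappa> < 1 \<and> 0 < \<rho> \<and> (\<forall>z. z \<in> sector (- of_real s) \<delta> \<longrightarrow> norm z < \<rho> \<longrightarrow>
           (\<exists>w. norm w > 1 / r \<and> z = Z w \<and> s * Re w \<ge> - \<kappa> * norm w))"
proof -
  define q where "q = \<bar>cos \<delta>\<bar>"
  have q: "0 \<le> q" "q < 1"
  proof -
    have "cos \<delta> < cos 0" "cos pi < cos \<delta>" using \<delta> by (intro cos_monotone_0_pi; simp)+
    then show "0 \<le> q" "q < 1" by (auto simp: q_def)
  qed
  define \<kappa> where "\<kappa> = (1 + q) / 2"
  have "0 \<in> F ` ball 0 r" using F_0 r by (metis centre_in_ball image_eqI)
  then obtain \<rho>0 where \<rho>0: "\<rho>0 > 0" "ball 0 \<rho>0 \<subseteq> F ` ball 0 r"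
    using open_F_image[of "ball 0 r"] openE by blast
  define \<rho> where "\<rho> = min \<rho>0 ((1 - q) / (8 * A + 8))"
  have \<rho>: "\<rho> > 0" using \<rho>0 q A by (simp add: \<rho>_def)
  have "\<exists>w. norm w > 1 / r \<and> z = Z w \<and> s * Re w \<ge> - \<kappa> * norm w"
    if z: "z \<in> sector (- of_real s) \<delta>" "norm z < \<rho>" for z
  proof -
    have "z \<in> F ` ball 0 r" using z \<rho>0 by (auto simp: \<rho>_def)
    then obtain u where u: "u \<in> ball 0 r" "z = F u" by blast
    have "z \<noteq> 0" using z by (simp add: sector_def)
    then have u0: "u \<noteq> 0" using u F_0 by auto
    have nz: "norm u \<le> 2 * norm z" "norm (z - u) \<le> A * norm u ^ 2"
      using norm_F_bounds[OF u(1)] F_close[OF u(1)] u(2) by simp_all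
    have "2 * A * norm u \<le> 4 * A * norm z" using nz(1) A mult_left_mono[of "norm u" "2 * norm z" "2 * A"] by simp
    also have "\<dots> \<le> 4 * A * ((1 - q) / (8 * A + 8))"
      using z(2) A by (intro mult_left_mono) (auto simp: \<rho>_def)
    also have "\<dots> \<le> (1 - q) / 2"
    proof -
      have "4 * A / (8 * A + 8) \<le> 1 / 2" using A by (simp add: field_simps)
      from mult_right_mono[OF this, of "1 - q"] q show ?thesis by simp
    qed
    finally have small: "2 * A * norm u \<le> (1 - q) / 2" .
    have s2: "s * s = 1" using s by (metis abs_mult_self_eq mult.right_neutral)
    have "Re (z / - of_real s) \<ge> cos \<delta> * norm z"
      by (rule Re_ge_of_sector[OF z(1) \<delta>]) (use s in simp)
    moreover have "z / - of_real s = - of_real s * z"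
    proof -
      have "(of_real s :: complex) * of_real s = 1" using s2 by (metis of_real_1 of_real_mult)
      then show ?thesis using s by (auto simp: field_simps)
    qed
    ultimately have "Re (- of_real s * z) \<ge> cos \<delta> * norm z" by (simp only:)
    then have 1: "- s * Re z \<ge> cos \<delta> * norm z" by simp
    have "cos \<delta> * norm z \<ge> - q * norm z"
      by (rule mult_right_mono) (auto simp: q_def)
    moreover have "norm z \<le> norm u + A * norm u ^ 2"
      using nz(2) norm_triangle_ineq2[of z u] by linarith
    then have "q * norm z \<le> q * (norm u + A * norm u ^ 2)" using q by (intro mult_left_mono)
    moreover have "q * (A * norm u ^ 2) \<le> 1 * (A * norm u ^ 2)"
      using q A by (intro mult_right_mono) auto
    ultimately have 2: "- s * Re z \<ge> - q * norm u - A * norm u ^ 2"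
      using 1 by (simp add: algebra_simps)
    have "\<bar>s * (Re z - Re u)\<bar> \<le> A * norm u ^ 2"
      using abs_Re_le_cmod[of "z - u"] nz(2) s by (simp add: abs_mult)
    then have "- s * Re u \<ge> - s * Re z - A * norm u ^ 2"
      by (simp add: abs_le_iff algebra_simps)
    moreover have "- q * norm u - A * norm u ^ 2 - A * norm u ^ 2 = - (q + 2 * A * norm u) * norm u"
      by (simp add: power2_eq_square algebra_simps)
    ultimately have "- s * Re u \<ge> - (q + 2 * A * norm u) * norm u" using 2 by linarith
    moreover have "(q + 2 * A * norm u) * norm u \<le> \<kappa> * norm u"
      using small by (intro mult_right_mono) (auto simp: \<kappa>_def field_simps)
    ultimately have key: "- s * Re u \<ge> - \<kappa> * norm u"
      unfolding mult_minus_left by linarith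
    define w where "w = - 1 / u"
    have wu: "- 1 / w = u" using u0 by (simp add: w_def)
    have "norm w > 1 / r" using u(1) u0 r by (simp add: w_def norm_divide frac_less2)
    moreover have "z = Z w" using u(2) wu by (simp add: Z_def)
    moreover have "s * Re w \<ge> - \<kappa> * norm w"
    proof -
      have "Re w = - Re u / norm u ^ 2"
        by (simp add: w_def Re_divide cmod_power2)
      then have "s * Re w = (- s * Re u) / norm u ^ 2" by simp
      also have "\<dots> \<ge> (- \<kappa> * norm u) / norm u ^ 2"
        using key by (intro divide_right_mono) auto
      also have "(- \<kappa> * norm u) / norm u ^ 2 = - \<kappa> * norm w"
        using u0 by (simp add: w_def norm_divide power2_eq_square)
      finally show ?thesis .
    qed
    ultimately show ?thesis by blast
  qed
  moreover have "0 < \<kappa>" "\<kappa> < 1" using q by (auto simp: \<kappa>_def)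
  ultimately show ?thesis using \<rho> by blast
qed

lemma cusp_subset: "\<bar>s\<bar> = 1 \<Longrightarrow> R \<ge> 2 / r \<Longrightarrow> cusp R s \<subseteq> {w. norm w > 2 / r}"
proof
  fix w assume *: "\<bar>s\<bar> = 1" "R \<ge> 2 / r" "w \<in> cusp R s"
  have "1 \<le> 2 / r" using r by simp
  then show "w \<in> {w. norm w > 2 / r}" using norm_cusp_gt[OF *(1) _ *(3)] *(2) by simp
qed

lemma cusp_subset': "\<bar>s\<bar> = 1 \<Longrightarrow> R \<ge> 2 / r \<Longrightarrow> cusp R s \<subseteq> {w. norm w > 1 / r}"
proof -
  assume "\<bar>s\<bar> = 1" "R \<ge> 2 / r"
  moreover have "1 / r \<le> 2 / r" using r by (simp add: divide_right_mono)
  ultimately show ?thesis using cusp_subset[of s R] by fastforce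
qed

text \<open>The map \<open>g\<close> is kept abstract so that one proof serves \<open>f\<close> with
  s = 1 and the local inverse of \<open>f\<close> with s = - 1.\<close>

lemma petal_cusp:
  assumes s: "\<bar>s\<bar> = 1" and R: "R \<ge> 2 / r"
    and g: "\<And>w. w \<in> cusp R s \<Longrightarrow> g (Z w) = Z (w + of_real s)"
  shows "petal g (- of_real s) (Z ` cusp R s)"
  unfolding petal_def
proof (intro conjI allI impI ballI)
  have s2: "s * s = 1" using s by (metis abs_mult_self_eq mult.right_neutral)
  note sub = cusp_subset'[OF s R]
  show "open (Z ` cusp R s)"
    by (rule open_mapping_thm3[OF holomorphic_on_subset[OF Z_holomorphic sub] open_cusp inj_on_subset[OF inj_Z sub]])
  have "homeomorphism (cusp R s) (Z ` cusp R s) Z (\<lambda>z. - 1 / Fi z)"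
  proof (rule homeomorphismI)
    show "continuous_on (cusp R s) Z"
      by (rule holomorphic_on_imp_continuous_on[OF holomorphic_on_subset[OF Z_holomorphic sub]])
    show "continuous_on (Z ` cusp R s) (\<lambda>z. - 1 / Fi z)"
      by (rule holomorphic_on_imp_continuous_on[OF holomorphic_on_subset[OF Zi_holomorphic Z_image[OF sub]]])
  qed (use Zi_Z sub in \<open>auto simp: subset_iff\<close>)
  then have "cusp R s homeomorphic Z ` cusp R s" unfolding homeomorphic_def by blast
  then show "simply_connected (Z ` cusp R s)"
    using simply_connected_cusp[OF s2] homeomorphic_simply_connected_eq by blast
  show "0 \<notin> Z ` cusp R s" using Z_image[OF sub] by blast
  show "g ` Z ` cusp R s \<subseteq> Z ` cusp R s" using g cusp_step[OF s2] by auto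
  show "(\<lambda>n. (g ^^ n) z) \<longlonglongrightarrow> 0" if zin: "z \<in> Z ` cusp R s" for z
  proof -
    obtain w where w: "w \<in> cusp R s" "z = Z w" using zin by blast
    have "(g ^^ n) z = Z (w + of_real (s * real n))" for n
    proof (induction n)
      case (Suc n)
      have "(g ^^ Suc n) z = g (Z (w + of_real (s * real n)))" using Suc.IH by simp
      also have "\<dots> = Z (w + of_real (s * real (Suc n)))"
        using g[OF cusp_orbit[OF s2 w(1)]] by (simp add: algebra_simps)
      finally show ?case .
    qed (use w in simp)
    then show ?thesis using Z_tendsto_orbit[OF s] by simp
  qed
  fix \<delta> assume \<delta>: "0 < \<delta> \<and> \<delta> < pi"
  then obtain \<kappa> \<rho> where k: "0 < \<kappa>" "\<kappa> < 1" "0 < \<rho>" "\<And>z. z \<in> sector (- of_real s) \<delta> \<Longrightarrow> norm z < \<rho> \<Longrightarrow>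
           \<exists>w. norm w > 1 / r \<and> z = Z w \<and> s * Re w \<ge> - \<kappa> * norm w"
    using sector_orbit_coordinate[OF s, of \<delta>] by blast
  obtain W where W: "W > 0" "\<And>w. norm w \<ge> W \<Longrightarrow> s * Re w \<ge> - \<kappa> * norm w \<Longrightarrow> w \<in> cusp R s"
    using sector_in_cusp[OF s k(1,2), of R] by blast
  \<comment> \<open>Since |Z w| is at least 1 / (2 |w|), the radius 1 / (2 W) forces |w| \<ge>
    W.\<close>
  have "sector (- of_real s) \<delta> \<inter> ball 0 (min \<rho> (1 / (2 * W))) \<subseteq> Z ` cusp R s"
  proof
    fix z assume z: "z \<in> sector (- of_real s) \<delta> \<inter> ball 0 (min \<rho> (1 / (2 * W)))"
    then obtain w where w: "norm w > 1 / r" "z = Z w" "s * Re w \<ge> - \<kappa> * norm w"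
      using k(4)[of z] by auto
    have "norm w > 0" using w(1) r by (meson divide_pos_pos less_trans zero_less_one)
    have "1 / norm w \<le> 2 * norm z" using Z_bounds(2)[OF w(1)] w(2) by simp
    also have "\<dots> < 1 / W" using z by simp
    finally have "norm w \<ge> W" using \<open>norm w > 0\<close> W(1) by (simp add: field_simps)
    from W(2)[OF this w(3)] show "z \<in> Z ` cusp R s" using w(2) by blast
  qed
  then show "\<exists>\<rho>>0. sector (- of_real s) \<delta> \<inter> ball 0 \<rho> \<subseteq> Z ` cusp R s"
    using k(3) W(1) by (intro exI[of _ "min \<rho> (1 / (2 * W))"]) auto
qed

text \<open>Halving the radius leaves room for one step of the model: |1 - u| \<ge> 1 / 2, as r
  \<le> 1. Hence the image of the half disc under F is taken as the domain of
  \<open>f\<close>.\<close>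

lemma model_in_ball: assumes "u \<in> ball 0 (r / 2)" shows "model u \<in> ball 0 r" "u \<noteq> 1"
proof -
  have u: "norm u < 1 / 2" "norm u < r / 2" using assms r by auto
  have "norm (1 - u) \<ge> 1 / 2" using norm_triangle_ineq2[of 1 u] u by simp
  then have "norm (model u) \<le> norm u / (1 / 2)"
    unfolding model_def norm_divide by (intro divide_left_mono) auto
  then show "model u \<in> ball 0 r" using u by simp
  show "u \<noteq> 1" using u by auto
qed

lemma half_ball: "ball 0 (r / 2) \<subseteq> (ball 0 r :: complex set)"
  using r by auto

lemma Fi_half: "z \<in> F ` ball 0 (r / 2) \<Longrightarrow> Fi z \<in> ball 0 (r / 2)"
  using Fi_F half_ball by auto

lemma f_holomorphic: "f holomorphic_on F ` ball 0 (r / 2)"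
proof -
  have "(\<lambda>z. model (Fi z)) holomorphic_on F ` ball 0 (r / 2)"
    unfolding model_def
    by (intro holomorphic_intros holomorphic_on_subset[OF Fi_hol])
       (use Fi_half model_in_ball(2) half_ball in fastforce)+
  then have "(F \<circ> (\<lambda>z. model (Fi z))) holomorphic_on F ` ball 0 (r / 2)"
    by (rule holomorphic_on_compose_gen[OF _ F_hol]) (use Fi_half model_in_ball(1) in blast)
  then show ?thesis by (simp add: f_def[abs_def] o_def)
qed

lemma f_inj: "inj_on f (F ` ball 0 (r / 2))"
proof (rule inj_onI)
  fix x y assume x: "x \<in> F ` ball 0 (r / 2)" and y: "y \<in> F ` ball 0 (r / 2)" and eq: "f x = f y"
  have "model (Fi x) = model (Fi y)"
    using eq inj_onD[OF inj_F] model_in_ball(1)[OF Fi_half[OF x]] model_in_ball(1)[OF Fi_half[OF y]]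
    unfolding f_def by blast
  then have "Fi x = Fi y"
    using model_in_ball(2)[OF Fi_half[OF x]] model_in_ball(2)[OF Fi_half[OF y]]
    by (simp add: model_def divide_simps) (simp add: algebra_simps)
  moreover have "F (Fi z) = z" if "z \<in> F ` ball 0 (r / 2)" for z
    using that Fi_F half_ball by auto
  ultimately show "x = y" using x y by metis
qed

lemma open_half: "open (F ` ball 0 (r / 2))" "0 \<in> F ` ball 0 (r / 2)"
  using open_F_image[OF open_ball half_ball] F_0 r by (auto intro!: image_eqI[of _ _ 0])

lemma attracting_petal_cusp:
  assumes R: "R \<ge> 2 / r" shows "attracting_petal f (Z ` cusp R 1)"
  unfolding attracting_petal_def
proof (intro exI conjI)
  have sub: "cusp R 1 \<subseteq> {w. norm w > 2 / r}" "cusp R 1 \<subseteq> {w. norm w > 1 / r}"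
    using R by (intro cusp_subset cusp_subset'; simp)+
  show "Z ` cusp R 1 \<subseteq> F ` ball 0 (r / 2)"
    using sub(1) Z_in_half by blast
  have "f (Z w) = Z (w + of_real 1)" if "w \<in> cusp R 1" for w
    using f_Z sub(2) that by auto
  from petal_cusp[OF _ R this] show "petal f (- 1) (Z ` cusp R 1)" by simp
qed (fact open_half f_holomorphic f_inj)+

lemma repelling_petal_cusp:
  assumes R: "R \<ge> 2 / r" shows "repelling_petal f (Z ` cusp R (- 1))"
  unfolding repelling_petal_def
proof (intro exI conjI)
  let ?U = "F ` ball 0 (r / 2)"
  have sub: "cusp R (- 1) \<subseteq> {w. norm w > 2 / r}" "cusp R (- 1) \<subseteq> {w. norm w > 1 / r}"
    using R by (intro cusp_subset cusp_subset'; simp)+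
  have inU: "Z w \<in> ?U" if "w \<in> cusp R (- 1)" for w
    using that sub(1) Z_in_half by blast
  have pred_in: "w - 1 \<in> cusp R (- 1)" if "w \<in> cusp R (- 1)" for w
    using cusp_step[of "- 1" w R] that by simp
  have fpred_in: "f (Z (w - 1)) = Z w" if "w \<in> cusp R (- 1)" for w
    using f_Z[of "w - 1"] pred_in[OF that] sub(2) by auto
  show "Z ` cusp R (- 1) \<subseteq> ?U \<inter> f ` ?U"
  proof clarify
    fix w assume w: "w \<in> cusp R (- 1)"
    show "Z w \<in> ?U \<inter> f ` ?U"
      using inU[OF w] fpred_in[OF w] inU[OF pred_in[OF w]] by (metis IntI image_eqI)
  qed
  have "inv_into ?U f (Z w) = Z (w + of_real (- 1))" if "w \<in> cusp R (- 1)" for w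
    using inv_into_f_eq[OF f_inj inU[OF pred_in[OF that]] fpred_in[OF that]] by simp
  from petal_cusp[OF _ R this] show "petal (inv_into ?U f) 1 (Z ` cusp R (- 1))" by simp
qed (fact open_half f_holomorphic f_inj)+


section \<open>Normal form of the germ and expansion of the trivialization\<close>

lemma f_analytic: "f analytic_on {0}"
  unfolding analytic_at using f_holomorphic open_half by blast

lemma f_0: "f 0 = 0"
  by (simp add: f_def Fi_0 model_def F_0)

text \<open>Writing Fi z = z p z, the difference of the two reciprocals is (1 - p z) / (z p z),
  which is analytic because p 0 = 1. That value comes from \<open>F_close\<close> at u = Fi z. The
  lemma feeds both the expansion of \<open>f\<close> and that of the trivialization.\<close>

lemma inverse_Fi_expansion:
  obtains h where "h analytic_on {0}" "\<forall>\<^sub>F z in at 0. 1 / Fi z = 1 / z + h z"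
proof -
  have nh: "\<forall>\<^sub>F z in nhds 0. z \<in> F ` ball 0 (r / 2)"
    using open_half by (intro eventually_nhds_in_open)
  then have half_at: "\<forall>\<^sub>F z in at 0. z \<in> F ` ball 0 (r / 2)"
    by (auto simp: eventually_at_filter elim: eventually_mono)
  have Fi_an: "Fi analytic_on {0}"
    unfolding analytic_at
    using holomorphic_on_subset[OF Fi_hol image_mono[OF half_ball]] open_half by blast
  obtain p where p: "p analytic_on {0}" "\<And>z. Fi z = z * p z"
    using analytic_divide_id[OF Fi_an Fi_0] by blast
  have lim_p: "(p \<longlongrightarrow> p 0) (at 0)"
    using analytic_at_imp_isCont[OF p(1)] by (simp add: isCont_def)
  have at0: "\<forall>\<^sub>F z in at (0::complex). z \<noteq> 0" by (simp add: eventually_at_filter)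
  have lim_Fi: "(Fi \<longlongrightarrow> 0) (at 0)"
    using analytic_at_imp_isCont[OF Fi_an] Fi_0 by (simp add: isCont_def)
  have le: "\<forall>\<^sub>F z in at 0. norm (p z - 1) \<le> norm (p z) * (A * norm (Fi z))"
    using at0 half_at
  proof eventually_elim
    case z: (elim z)
    then obtain u where u: "u \<in> ball 0 r" "z = F u" using half_ball by blast
    have "norm (z - Fi z) \<le> A * norm (Fi z) ^ 2"
      using F_close[OF u(1)] u Fi_F by simp
    then have "norm z * norm (1 - p z) \<le> norm z * (norm (p z) * (A * norm (Fi z)))"
      by (simp add: p(2) norm_mult[symmetric] algebra_simps power2_eq_square)
    then show "norm (p z - 1) \<le> norm (p z) * (A * norm (Fi z))"
      using z(1) by (simp add: norm_minus_commute)
  qed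
  have "((\<lambda>z. norm (p z) * (A * norm (Fi z))) \<longlongrightarrow> norm (p 0) * (A * norm (0::complex))) (at 0)"
    by (intro tendsto_intros lim_p lim_Fi)
  then have "((\<lambda>z. norm (p z) * (A * norm (Fi z))) \<longlongrightarrow> 0) (at 0)" by simp
  from Lim_null_comparison[OF le this] have "((\<lambda>z. p z - 1) \<longlongrightarrow> 0) (at 0)" .
  then have "(p \<longlongrightarrow> 1) (at 0)" by (simp add: LIM_zero_iff)
  then have p0: "p 0 = 1" using lim_p tendsto_unique[of "at (0::complex)"] by force
  have "(\<lambda>z. 1 - p z) analytic_on {0}" using p(1) by (intro analytic_intros)
  from analytic_divide_id[OF this] obtain p2 where p2: "p2 analytic_on {0}" "\<And>z. 1 - p z = z * p2 z"
    using p0 by auto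
  have "\<forall>\<^sub>F z in at 0. p z \<noteq> 0"
    using tendsto_imp_eventually_ne[OF lim_p] p0 by simp
  then have "\<forall>\<^sub>F z in at 0. 1 / Fi z = 1 / z + p2 z / p z"
    using at0
  proof eventually_elim
    case (elim z)
    have "1 / z + p2 z / p z = (p z + z * p2 z) / (z * p z)" using elim by (simp add: field_simps)
    also have "p z + z * p2 z = 1" using p2(2)[of z] by (simp add: algebra_simps)
    finally show ?case by (simp add: p(2))
  qed
  moreover have "(\<lambda>z. p2 z / p z) analytic_on {0}"
    using p p2 p0 by (intro analytic_intros) auto
  ultimately show thesis by (intro that)
qed

text \<open>A bootstrap on 1 / f z = 1 / z - 1 + \<epsilon> z with \<epsilon> z = h z - h (f z).
  Boundedness of \<epsilon> gives f z - z = O(z^2); the second-order expansion of \<open>h\<close>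
  then gives \<epsilon> = O(z^2), and so f z - z - z f z = O(z^4). Thus the cubic coefficient comes
  out as 1 for every germ analytically conjugate to the model in this way.\<close>

lemma f_expansion: "(\<lambda>z. f z - (z + z^2 + z^3)) \<in> O[at 0](\<lambda>z. z ^ 4)"
proof -
  obtain h where h: "h analytic_on {0}" "\<forall>\<^sub>F z in at 0. 1 / Fi z = 1 / z + h z"
    using inverse_Fi_expansion .
  define \<epsilon> where "\<epsilon> = (\<lambda>z. h z - h (f z))"
  have h_f_an: "(\<lambda>z. k (f z)) analytic_on {0}" if "k analytic_on {0}" for k
    using analytic_on_compose[OF f_analytic, of k] that f_0 by (simp add: o_def)
  have bounded: "k \<in> O[at 0](\<lambda>_. 1)" if "k analytic_on {0}" for k :: "complex \<Rightarrow> complex"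
    using analytic_at_imp_isCont[OF that] by (intro bigoI_tendsto[of _ _ "k 0"]) (auto simp: isCont_def)
  have f_id: "f \<in> O[at 0](\<lambda>z. z)"
    using analytic_diff_const_bigo[OF f_analytic] f_0 by simp
  have f_ne: "\<forall>\<^sub>F z in at 0. z \<in> F ` ball 0 (r / 2) - {0}"
    using eventually_nhds_in_open[OF open_half(1,2)] by (auto simp: eventually_at_filter elim: eventually_mono)
  have f_at: "filterlim f (at 0) (at 0)"
    unfolding filterlim_at
  proof
    show "\<forall>\<^sub>F z in at 0. f z \<in> UNIV \<and> f z \<noteq> 0"
      using f_ne
    proof eventually_elim
      case (elim z)
      then have "f z \<noteq> f 0" using inj_onD[OF f_inj, of z 0] open_half by auto
      then show ?case using f_0 by simp
    qed
    show "(f \<longlongrightarrow> 0) (at 0)" using analytic_at_imp_isCont[OF f_analytic] f_0 by (simp add: isCont_def)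
  qed
  have rel: "\<forall>\<^sub>F z in at 0. f z - z - z * f z = - f z * z * \<epsilon> z"
    using f_ne h(2) eventually_compose_filterlim[OF h(2) f_at] eventually_compose_filterlim[OF f_ne f_at]
  proof eventually_elim
    case (elim z)
    have Fz: "Fi z \<in> ball 0 (r / 2)" using Fi_half elim by blast
    have "Fi (f z) = model (Fi z)"
      unfolding f_def by (rule Fi_F[OF model_in_ball(1)[OF Fz]])
    moreover have "Fi z \<noteq> 0"
      using elim(1) F_0 Fi_F half_ball by auto
    ultimately have "1 / Fi (f z) = 1 / Fi z - 1"
      by (simp add: model_def diff_divide_distrib)
    with elim have "1 / f z = 1 / z - 1 + \<epsilon> z" by (simp add: \<epsilon>_def algebra_simps)
    then have "z * f z * (1 / f z) = z * f z * (1 / z - 1 + \<epsilon> z)" by simp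
    then have "z = f z - z * f z + z * f z * \<epsilon> z" using elim by (simp add: algebra_simps)
    then show ?case by (simp add: algebra_simps)
  qed
  have \<epsilon>_an: "\<epsilon> analytic_on {0}"
    unfolding \<epsilon>_def using h h_f_an by (intro analytic_intros)
  have "(\<lambda>z. - f z * z * \<epsilon> z) \<in> O[at 0](\<lambda>z. z * z * 1)"
    using f_id by (intro landau_o.big.mult bounded \<epsilon>_an) auto
  then have "(\<lambda>z. f z - z - z * f z) \<in> O[at 0](\<lambda>z. z ^ 2)"
    using landau_o.big.in_cong[OF rel] by (simp add: power2_eq_square)
  moreover have "(\<lambda>z. z * f z) \<in> O[at 0](\<lambda>z. z ^ 2)"
    unfolding power2_eq_square using f_id by (intro landau_o.big.mult) auto
  ultimately have "(\<lambda>z. (f z - z - z * f z) + z * f z) \<in> O[at 0](\<lambda>z. z ^ 2)"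
    by (rule sum_in_bigo)
  then have f_diff: "(\<lambda>z. f z - z) \<in> O[at 0](\<lambda>z. z ^ 2)" by simp
  have "(\<lambda>z. h z - h 0) analytic_on {0}" using h by (intro analytic_intros)
  from analytic_divide_id[OF this] obtain h1 where h1: "h1 analytic_on {0}" "\<And>z. h z - h 0 = z * h1 z" by auto
  have "(\<lambda>z. h1 z - h1 0) analytic_on {0}" using h1 by (intro analytic_intros)
  from analytic_divide_id[OF this] obtain h2 where h2: "h2 analytic_on {0}" "\<And>z. h1 z - h1 0 = z * h2 z" by auto
  have h_exp: "h z = h 0 + z * h1 0 + z^2 * h2 z" for z
    using h1(2)[of z] h2(2)[of z] by (simp add: power2_eq_square algebra_simps)
  have "\<epsilon> = (\<lambda>z. - h1 0 * (f z - z) + z^2 * h2 z - f z * f z * h2 (f z))"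
    unfolding \<epsilon>_def by (rule ext, subst (1 2) h_exp) (simp add: power2_eq_square algebra_simps)
  moreover have "(\<lambda>z. - h1 0 * (f z - z)) \<in> O[at 0](\<lambda>z. z ^ 2)" using f_diff by simp
  moreover have "(\<lambda>z. z^2 * h2 z) \<in> O[at 0](\<lambda>z. z ^ 2 * 1)"
    by (intro landau_o.big.mult bounded h2) auto
  moreover have "(\<lambda>z. f z * f z * h2 (f z)) \<in> O[at 0](\<lambda>z. z * z * 1)"
    by (intro landau_o.big.mult bounded h_f_an h2 f_id)
  ultimately have \<epsilon>2: "\<epsilon> \<in> O[at 0](\<lambda>z. z ^ 2)"
    by (auto simp: power2_eq_square intro!: sum_in_bigo)
  have "(\<lambda>z. - f z * z * \<epsilon> z) \<in> O[at 0](\<lambda>z. z * z * z ^ 2)"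
    using f_id by (intro landau_o.big.mult \<epsilon>2) auto
  then have 4: "(\<lambda>z. f z - z - z * f z) \<in> O[at 0](\<lambda>z. z ^ 4)"
    using landau_o.big.in_cong[OF rel] by (simp add: power2_eq_square power4_eq_xxxx mult.assoc)
  \<comment> \<open>Since (1 - z) (1 + z + z^2) = 1 - z^3, multiplying (1 - z) f z - z by this
    polynomial gives f z - (z + z^2 + z^3) up to z^3 f z, itself O(z^4).\<close>
  have poly: "(\<lambda>z::complex. 1 + z + z^2) \<in> O[at 0](\<lambda>_. 1)"
    by (intro bounded analytic_intros)
  have "(\<lambda>z. (f z - z - z * f z) * (1 + z + z^2)) \<in> O[at 0](\<lambda>z. z ^ 4 * 1)"
    by (intro landau_o.big.mult 4 poly)
  moreover have "(\<lambda>z. z^3 * f z) \<in> O[at 0](\<lambda>z. z ^ 3 * z)"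
    by (intro landau_o.big.mult f_id) auto
  moreover have "z ^ 3 * z = z ^ 4" for z :: complex by (simp add: eval_nat_numeral)
  ultimately have "(\<lambda>z. (f z - z - z * f z) * (1 + z + z^2) + z^3 * f z) \<in> O[at 0](\<lambda>z. z ^ 4)"
    by (intro sum_in_bigo) simp_all
  moreover have "(f z - z - z * f z) * (1 + z + z^2) + z^3 * f z = f z - (z + z^2 + z^3)" for z
    by (simp add: power2_eq_square power3_eq_cube algebra_simps)
  ultimately show ?thesis by simp
qed

lemma f_expansion2: "(\<lambda>z. f z - z - z^2) \<in> O[at 0](\<lambda>z. z ^ 3)"
proof -
  have "(\<lambda>z. (f z - (z + z^2 + z^3)) + z^3) \<in> O[at 0](\<lambda>z. z ^ 3)"
    by (intro sum_in_bigo bigo_power_mono[OF _ f_expansion]) auto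
  then show ?thesis by (simp add: algebra_simps)
qed

lemma prenormalized_f: "prenormalized f"
  unfolding prenormalized_def
proof
  have "(\<lambda>z::complex. z ^ 4) \<in> o[at 0](\<lambda>z. z ^ 3)"
  proof (rule smalloI_tendsto)
    have "((\<lambda>z::complex. z) \<longlongrightarrow> 0) (at 0)" by (rule tendsto_ident_at)
    moreover have "\<forall>\<^sub>F z in at (0::complex). z ^ 4 / z ^ 3 = z"
      by (auto simp: eventually_at_filter eval_nat_numeral)
    ultimately show "((\<lambda>z::complex. z ^ 4 / z ^ 3) \<longlongrightarrow> 0) (at 0)"
      using tendsto_cong by fast
  qed (auto simp: eventually_at_filter)
  from landau_o.big_small_trans[OF f_expansion this]
  show "(\<lambda>z. f z - (z + z^2 + z^3)) \<in> o[at 0](\<lambda>z. z ^ 3)" .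
qed (rule f_analytic)

lemma attracting_trivialization_cusp:
  assumes R: "R \<ge> 2 / r"
  shows "attracting_trivialization f (Z ` cusp R 1) (\<lambda>z. - 1 / Fi z)"
  unfolding attracting_trivialization_def
proof (intro conjI ballI)
  have sub: "cusp R 1 \<subseteq> {w. norm w > 1 / r}"
    using R by (intro cusp_subset') simp
  show "(\<lambda>z. - 1 / Fi z) holomorphic_on Z ` cusp R 1"
    by (rule holomorphic_on_subset[OF Zi_holomorphic Z_image[OF sub]])
  show "- 1 / Fi (f z) - - 1 / Fi z = 1" if z: "z \<in> Z ` cusp R 1" for z
  proof -
    obtain w where w: "w \<in> cusp R 1" "z = Z w" using z by blast
    have "w + 1 \<in> cusp R 1" using cusp_step[of 1 w R] w by simp
    then have "- 1 / Fi (Z (w + 1)) = w + 1" using sub by (intro Zi_Z) auto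
    moreover have "- 1 / Fi (Z w) = w" "f z = Z (w + 1)" using sub w Zi_Z[of w] f_Z by auto
    ultimately show ?thesis using w(2) by simp
  qed
  obtain h where h: "h analytic_on {0}" "\<forall>\<^sub>F z in at 0. 1 / Fi z = 1 / z + h z"
    using inverse_Fi_expansion .
  have "(\<lambda>z. - h z) analytic_on {0}" using h by (intro analytic_intros)
  from analytic_asymptotic_expansion[OF this] obtain a where
    a: "\<And>N. (\<lambda>z. - h z - (\<Sum>k<N. a k * z ^ k)) \<in> O[at 0](\<lambda>z. z ^ N)" by blast
  have "asymptotic_on (- 1) (Z ` cusp R 1) (\<lambda>z. - 1 / Fi z + 1 / z) (Abs_fps a)"
    unfolding asymptotic_on_def
  proof (intro allI impI)
    fix \<delta> :: real and N
    let ?S = "Z ` cusp R 1 \<inter> sector (- 1) \<delta>"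
    have le: "at 0 within ?S \<le> at 0" by (rule at_le) simp
    have "\<forall>\<^sub>F z in at 0. - h z - (\<Sum>k<N. a k * z ^ k) = - 1 / Fi z + 1 / z - (\<Sum>k<N. fps_nth (Abs_fps a) k * z ^ k)"
      using h(2) by eventually_elim (simp add: algebra_simps)
    then have "(\<lambda>z. - 1 / Fi z + 1 / z - (\<Sum>k<N. fps_nth (Abs_fps a) k * z ^ k)) \<in> O[at 0](\<lambda>z. z ^ N)"
      by (rule iffD1[OF landau_o.big.in_cong a[of N]])
    then show "(\<lambda>z. - 1 / Fi z + 1 / z - (\<Sum>k<N. fps_nth (Abs_fps a) k * z ^ k)) \<in> O[at 0 within ?S](\<lambda>z. z ^ N)"
      by (rule landau_o.big.filter_mono[OF le])
  qed
  then show "\<exists>a. asymptotic_on (- 1) (Z ` cusp R 1) (\<lambda>z. - 1 / Fi z + 1 / z) a" by blast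
qed

end

section \<open>Sectorial solutions\<close>

context model_conjugacy
begin

text \<open>The right-hand side of the equation for \<open>R\<close>, with its removable singularity
  at 0 filled.\<close>

definition B :: "complex \<Rightarrow> complex" where
  "B z = (if z = 0 then 0 else - z + Ln (f z / z))"

text \<open>Since f z / z = 1 + z + O(z^2), the logarithm cancels the term - z. The resulting order
  2 is what makes the half sums converge and the formal equation solvable.\<close>

lemma B_analytic: "B analytic_on {0}" and B_bigo: "B \<in> O[at 0](\<lambda>z. z ^ 2)"
proof -
  obtain q where q: "q analytic_on {0}" "\<And>z. f z = z * q z"
    using analytic_divide_id[OF f_analytic f_0] by blast
  have "(\<lambda>z. f z - z - z^2) analytic_on {0}" using f_analytic by (intro analytic_intros)
  from analytic_bigo_power_factor[OF this f_expansion2] obtain k where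
    k: "k analytic_on {0}" "\<forall>\<^sub>F z in at 0. f z - z - z^2 = z ^ 3 * k z" by blast
  have at0: "\<forall>\<^sub>F z in at (0::complex). z \<noteq> 0" by (simp add: eventually_at_filter)
  have q_eq: "\<forall>\<^sub>F z in at 0. q z = 1 + (z + z^2 * k z)"
    using k(2) at0
  proof eventually_elim
    case (elim z)
    then have "z * q z = z * (1 + (z + z^2 * k z))"
      by (simp add: q(2) power2_eq_square power3_eq_cube algebra_simps)
    then show ?case using elim by simp
  qed
  have lims: "(q \<longlongrightarrow> q 0) (at 0)" "(k \<longlongrightarrow> k 0) (at 0)"
    using analytic_at_imp_isCont[OF q(1)] analytic_at_imp_isCont[OF k(1)] by (simp_all add: isCont_def)
  have "((\<lambda>z. 1 + (z + z^2 * k z)) \<longlongrightarrow> 1 + (0 + 0^2 * k 0)) (at 0)"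
    by (intro tendsto_intros lims)
  then have "((\<lambda>z. 1 + (z + z^2 * k z)) \<longlongrightarrow> 1) (at 0)" by simp
  with lims(1) have q0: "q 0 = 1"
    using tendsto_cong[OF q_eq] tendsto_unique[of "at (0::complex)"] by force
  have B_eq: "B = (\<lambda>z. - z + Ln (q z))"
    using q0 by (auto simp: B_def q(2) fun_eq_iff)
  show "B analytic_on {0}"
    unfolding B_eq using q q0 by (intro analytic_intros) auto
  have t: "(\<lambda>z. z + z^2 * k z) \<in> O[at 0](\<lambda>z. z)"
  proof (rule sum_in_bigo(1))
    have "k \<in> O[at 0](\<lambda>_. 1)"
      using lims(2) by (intro bigoI_tendsto[of _ _ "k 0"]) auto
    then have "(\<lambda>z. z^2 * k z) \<in> O[at 0](\<lambda>z. z^2 * 1)" by (intro landau_o.big.mult) auto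
    then show "(\<lambda>z. z^2 * k z) \<in> O[at 0](\<lambda>z. z)"
      using bigo_power_mono[of 1 2 "\<lambda>z. z^2 * k z"] by simp
  qed simp
  have t0: "((\<lambda>z. z + z^2 * k z) \<longlongrightarrow> 0 + 0^2 * k 0) (at 0)"
    by (intro tendsto_intros lims)
  then have "\<forall>\<^sub>F z in at 0. norm (z + z^2 * k z) < 1 / 2"
    using order_tendstoD(2)[OF tendsto_norm[OF t0], of "1 / 2"] by simp
  then have "\<forall>\<^sub>F z in at 0. norm (Ln (1 + (z + z^2 * k z)) - (z + z^2 * k z)) \<le> 2 * norm ((z + z^2 * k z)^2)"
  proof eventually_elim
    case (elim z)
    let ?t = "z + z^2 * k z"
    have "norm (Ln (1 + ?t) - ?t) \<le> norm ?t ^ 2 / (1 - norm ?t)"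
      using elim by (intro Ln_approx_linear) simp
    also have "\<dots> \<le> norm ?t ^ 2 / (1 / 2)" using elim by (intro divide_left_mono) auto
    finally show ?case by (simp add: norm_power)
  qed
  then have "(\<lambda>z. Ln (1 + (z + z^2 * k z)) - (z + z^2 * k z)) \<in> O[at 0](\<lambda>z. (z + z^2 * k z)^2)"
    by (rule bigoI)
  also have "(\<lambda>z. (z + z^2 * k z)^2) \<in> O[at 0](\<lambda>z. z ^ 2)"
    by (rule landau_o.big_power[OF t])
  finally have 1: "(\<lambda>z. Ln (1 + (z + z^2 * k z)) - (z + z^2 * k z)) \<in> O[at 0](\<lambda>z. z ^ 2)" .
  have "k \<in> O[at 0](\<lambda>_. 1)"
    using lims(2) by (intro bigoI_tendsto[of _ _ "k 0"]) auto
  then have "(\<lambda>z. z^2 * k z) \<in> O[at 0](\<lambda>z. z^2 * 1)" by (intro landau_o.big.mult) auto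
  then have sum: "(\<lambda>z. (Ln (1 + (z + z^2 * k z)) - (z + z^2 * k z)) + z^2 * k z) \<in> O[at 0](\<lambda>z. z ^ 2)"
    by (intro sum_in_bigo 1) simp
  have "\<forall>\<^sub>F z in at 0. (Ln (1 + (z + z^2 * k z)) - (z + z^2 * k z)) + z^2 * k z = B z"
    using q_eq by eventually_elim (simp add: B_eq)
  from landau_o.big.in_cong[OF this] sum show "B \<in> O[at 0](\<lambda>z. z ^ 2)" by blast
qed

lemma B_Z: "norm w > 1 / r \<Longrightarrow> B (Z w) = - Z w + Ln (f (Z w) / Z w)"
  using Z_nonzero by (simp add: B_def)

lemma bigo_comp_Z:
  assumes "e \<in> O[at 0](\<lambda>z. z ^ n)"
  shows "\<exists>C W. 0 \<le> C \<and> 2 / r \<le> W \<and> (\<forall>w. W \<le> norm w \<longrightarrow> norm (e (Z w)) \<le> C / norm w ^ n)"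
proof -
  obtain c where c: "c > 0" "\<forall>\<^sub>F z in at 0. norm (e z) \<le> c * norm (z ^ n)"
    using assms by (elim landau_o.bigE)
  then obtain d where d: "d > 0" "\<And>z. z \<noteq> 0 \<Longrightarrow> norm z < d \<Longrightarrow> norm (e z) \<le> c * norm z ^ n"
    by (auto simp: eventually_at norm_power)
  define W where "W = max (2 / r) (2 / d + 1)"
  show ?thesis
  proof (intro exI conjI allI impI)
    fix w :: complex assume w: "norm w \<ge> W"
    have "1 / r < 2 / r" using r by (simp add: divide_strict_right_mono)
    then have w1: "norm w > 1 / r" using w by (simp add: W_def)
    have "2 / d < norm w" using w by (simp add: W_def)
    moreover have "0 < 2 / d" using d by simp
    ultimately have wpos: "norm w > 0" by linarith
    with \<open>2 / d < norm w\<close> d(1) have "2 / norm w < d" by (simp add: field_simps)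
    then have "norm (Z w) < d" using Z_bounds(1)[OF w1] by linarith
    from d(2)[OF Z_nonzero[OF w1] this]
    have "norm (e (Z w)) \<le> c * norm (Z w) ^ n" .
    also have "\<dots> \<le> c * (2 / norm w) ^ n"
      using c Z_bounds(1)[OF w1] by (intro mult_left_mono power_mono) auto
    finally show "norm (e (Z w)) \<le> c * 2 ^ n / norm w ^ n" by (simp add: power_divide)
  qed (use c in \<open>auto simp: W_def\<close>)
qed

lemma B_orbit_summand:
  obtains W M where "W \<ge> 2 / r" "(\<lambda>w. B (Z w)) holomorphic_on {w. norm w > W}"
    "\<And>w. norm w > W \<Longrightarrow> norm (B (Z w)) \<le> M / norm w ^ 2"
proof -
  obtain C W where W: "W \<ge> 2 / r" "\<And>w. norm w \<ge> W \<Longrightarrow> norm (B (Z w)) \<le> C / norm w ^ 2"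
    using bigo_comp_Z[OF B_bigo] by blast
  obtain T where T: "open T" "0 \<in> T" "B holomorphic_on T"
    using B_analytic by (auto simp: analytic_at)
  then have "\<forall>\<^sub>F w in at_infinity. Z w \<in> T"
    using topological_tendstoD[OF Z_tendsto] by blast
  then obtain W2 where W2: "\<And>w. norm w \<ge> W2 \<Longrightarrow> Z w \<in> T"
    by (auto simp: eventually_at_infinity)
  define W3 where "W3 = max W W2"
  have "1 / r \<le> 2 / r" using r by (simp add: divide_right_mono)
  then have sub: "{w. norm w > W3} \<subseteq> {w. norm w > 1 / r}"
    using W(1) by (auto simp: W3_def)
  show thesis
  proof (rule that[of W3 C])
    show "(\<lambda>w. B (Z w)) holomorphic_on {w. norm w > W3}"
      by (rule holomorphic_on_compose_gen[OF holomorphic_on_subset[OF Z_holomorphic sub] T(3), unfolded o_def])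
         (use W2 in \<open>auto simp: W3_def\<close>)
  qed (use W in \<open>auto simp: W3_def\<close>)
qed

text \<open>The difference of \<open>Q\<close> and the truncated formal solution has increments of
  order N + 2 in 1 / w and tends to 0 along orbits, so \<open>telescoping_decay\<close> applies. The
  limit condition \<open>Qlim\<close> rules out an additive constant; 1 / |w| \<le> 2 |z| translates
  the result back to z.\<close>

lemma asymptotic_cusp_aux:
  fixes Q :: "complex \<Rightarrow> complex" and a :: "nat \<Rightarrow> complex"
  assumes s: "s = 1 \<or> s = - 1" and R: "R \<ge> 2 / r"
    and a: "(\<lambda>z. (\<Sum>k<N. a k * (f z ^ Suc k - z ^ Suc k)) - B z) \<in> O[at 0](\<lambda>z. z ^ (N + 2))"
    and Qstep: "\<And>w. w \<in> cusp R s \<Longrightarrow> w + 1 \<in> cusp R s \<Longrightarrow> Q (w + 1) - Q w = B (Z w)"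
    and Qlim: "\<And>w. w \<in> cusp R s \<Longrightarrow> (\<lambda>n. Q (w + of_real (s * real n))) \<longlonglongrightarrow> 0"
    and \<delta>: "0 < \<delta>" "\<delta> < pi"
  shows "(\<lambda>z. Q (- 1 / Fi z) - (\<Sum>k<N. a k * z ^ Suc k))
           \<in> O[at 0 within (Z ` cusp R s \<inter> sector (- of_real s) \<delta>)](\<lambda>z. z ^ (N + 1))"
proof -
  have s1: "\<bar>s\<bar> = 1" and s2: "s * s = 1" using s by auto
  have sub: "cusp R s \<subseteq> {w. norm w > 1 / r}" by (rule cusp_subset'[OF s1 R])
  define P where "P z = (\<Sum>k<N. a k * z ^ Suc k)" for z
  define \<rho> where "\<rho> w = Q w - P (Z w)" for w
  obtain C W where W: "C \<ge> 0" "W \<ge> 2 / r"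
    "\<And>w. norm w \<ge> W \<Longrightarrow> norm ((\<Sum>k<N. a k * (f (Z w) ^ Suc k - Z w ^ Suc k)) - B (Z w)) \<le> C / norm w ^ (N + 2)"
    using bigo_comp_Z[OF a] by blast
  have fwd: "norm (\<rho> (w + 1) - \<rho> w) \<le> C / norm w ^ (N + 2)"
    if "w \<in> cusp R s" "w + 1 \<in> cusp R s" "norm w \<ge> W" for w
  proof -
    have "norm w > 1 / r" using that sub by blast
    then have "\<rho> (w + 1) - \<rho> w = - ((\<Sum>k<N. a k * (f (Z w) ^ Suc k - Z w ^ Suc k)) - B (Z w))"
      using Qstep[OF that(1,2)]
      by (simp add: \<rho>_def P_def f_Z sum_subtractf right_diff_distrib del: power_Suc)
    then show ?thesis using W(3)[OF that(3)] by (simp only: norm_minus_cancel)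
  qed
  \<comment> \<open>For s = - 1 the step from w to w - 1 is the equation at w - 1, whose modulus is
    at least |w| / 2. The factor 2^(N+2) and the threshold W + 1 pay for this.\<close>
  have inc: "norm (\<rho> (w + of_real s) - \<rho> w) \<le> C * 2 ^ (N + 2) / norm w ^ (N + 2)"
    if w: "w \<in> cusp R s" "norm w \<ge> max 2 (W + 1)" for w
  proof (cases "s = 1")
    case True
    then have "norm (\<rho> (w + of_real s) - \<rho> w) \<le> C / norm w ^ (N + 2)"
      using fwd[OF w(1)] cusp_step[OF s2 w(1)] w(2) by simp
    also have "\<dots> \<le> C * 2 ^ (N + 2) / norm w ^ (N + 2)"
    proof (rule divide_right_mono)
      have "(1::real) \<le> 2 ^ (N + 2)" by (rule one_le_power) simp
      from mult_left_mono[OF this W(1)] show "C \<le> C * 2 ^ (N + 2)" by simp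
    qed simp
    finally show ?thesis .
  next
    case False
    then have sm: "s = - 1" using s by simp
    have ge: "norm (w - 1) \<ge> norm w - 1" using norm_triangle_ineq2[of w 1] by simp
    have n: "norm w \<ge> 2" "norm w \<ge> W + 1" using w by auto
    have w1: "w - 1 \<in> cusp R s" using cusp_step[OF s2 w(1)] sm by simp
    have "norm (\<rho> (w + of_real s) - \<rho> w) = norm (\<rho> (w - 1 + 1) - \<rho> (w - 1))"
      using sm by (simp add: norm_minus_commute)
    also have "\<dots> \<le> C / norm (w - 1) ^ (N + 2)"
      using fwd[OF w1] w(1) ge n by simp
    also have "\<dots> \<le> C / (norm w / 2) ^ (N + 2)"
      using W(1) ge n by (intro divide_left_mono power_mono mult_pos_pos zero_less_power) auto
    finally show ?thesis by (simp only: power_divide) simp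
  qed
  have lim: "(\<lambda>n. \<rho> (w + of_real (s * real n))) \<longlonglongrightarrow> 0" if "w \<in> cusp R s" for w
  proof -
    have "(\<lambda>n. Q (w + of_real (s * real n)) - P (Z (w + of_real (s * real n)))) \<longlonglongrightarrow> 0 - (\<Sum>k<N. a k * 0 ^ Suc k)"
      unfolding P_def by (intro tendsto_intros Qlim[OF that] Z_tendsto_orbit[OF s1])
    then show ?thesis by (simp add: \<rho>_def)
  qed
  obtain \<kappa> \<eta> where k: "0 < \<kappa>" "\<kappa> < 1" "0 < \<eta>" "\<And>z. z \<in> sector (- of_real s) \<delta> \<Longrightarrow> norm z < \<eta> \<Longrightarrow>
           \<exists>w. norm w > 1 / r \<and> z = Z w \<and> s * Re w \<ge> - \<kappa> * norm w"
    using sector_orbit_coordinate[OF s1 \<delta>] by blast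
  have "\<exists>C' W'. 0 \<le> C' \<and> (\<forall>w\<in>cusp R s. norm w \<ge> W' \<longrightarrow> s * Re w \<ge> - \<kappa> * norm w \<longrightarrow> norm (\<rho> w) \<le> C' / norm w ^ (N + 1))"
    by (rule telescoping_decay[where W = "max 2 (W + 1)", OF s1 less_imp_le[OF k(1)] k(2) _ cusp_step[OF s2] inc lim])
       (use W(1) in simp_all)
  then obtain C' W' where C': "0 \<le> C'"
    "\<And>w. w \<in> cusp R s \<Longrightarrow> norm w \<ge> W' \<Longrightarrow> s * Re w \<ge> - \<kappa> * norm w \<Longrightarrow> norm (\<rho> w) \<le> C' / norm w ^ (N + 1)"
    by blast
  define d where "d = min \<eta> (1 / (2 * max 1 W'))"
  have d: "d > 0" using k by (simp add: d_def)
  have "norm (Q (- 1 / Fi z) - P z) \<le> C' * 2 ^ (N + 1) * norm (z ^ (N + 1))"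
    if z: "z \<in> Z ` cusp R s \<inter> sector (- of_real s) \<delta>" "norm z < d" for z
  proof -
    obtain w where w: "norm w > 1 / r" "z = Z w" "s * Re w \<ge> - \<kappa> * norm w"
      using k(4)[of z] z by (auto simp: d_def)
    obtain w' where w': "w' \<in> cusp R s" "z = Z w'" using z by blast
    have "w = w'" using w w' sub inj_onD[OF inj_Z, of w w'] by blast
    have wpos: "norm w > 0" using w(1) r by (meson divide_pos_pos less_trans zero_less_one)
    have inv: "1 / norm w \<le> 2 * norm z" using Z_bounds(2)[OF w(1)] w(2) by simp
    also have "\<dots> < 1 / max 1 W'" using z(2) by (simp add: d_def)
    finally have "norm w \<ge> max 1 W'" using wpos by (simp add: field_simps)
    then have "norm (\<rho> w) \<le> C' / norm w ^ (N + 1)" using C'(2)[of w] w w' \<open>w = w'\<close> by simp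
    also have "\<dots> = C' * (1 / norm w) ^ (N + 1)" by (simp only: power_divide) simp
    also have "\<dots> \<le> C' * (2 * norm z) ^ (N + 1)"
      using inv C'(1) by (intro mult_left_mono power_mono) auto
    also have "\<dots> = C' * 2 ^ (N + 1) * norm (z ^ (N + 1))"
      by (simp only: power_mult_distrib norm_power mult.assoc)
    finally show ?thesis using Zi_Z[OF w(1)] w(2) by (simp add: \<rho>_def)
  qed
  then show ?thesis
    unfolding P_def using d
    by (intro bigoI[of _ "C' * 2 ^ (N + 1)"]) (auto simp: eventually_at intro!: exI[of _ d])
qed

lemma asymptotic_cusp:
  fixes Q :: "complex \<Rightarrow> complex" and a :: "nat \<Rightarrow> complex"
  assumes s: "s = 1 \<or> s = - 1" and R: "R \<ge> 2 / r"
    and a: "\<And>N. (\<lambda>z. (\<Sum>k<N. a k * (f z ^ Suc k - z ^ Suc k)) - B z) \<in> O[at 0](\<lambda>z. z ^ (N + 2))"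
    and Qstep: "\<And>w. w \<in> cusp R s \<Longrightarrow> w + 1 \<in> cusp R s \<Longrightarrow> Q (w + 1) - Q w = B (Z w)"
    and Qlim: "\<And>w. w \<in> cusp R s \<Longrightarrow> (\<lambda>n. Q (w + of_real (s * real n))) \<longlonglongrightarrow> 0"
  shows "asymptotic_on (- of_real s) (Z ` cusp R s) (\<lambda>z. Q (- 1 / Fi z)) (fps_X * Abs_fps a)"
  unfolding asymptotic_on_def
proof (intro allI impI)
  fix \<delta> :: real and N assume \<delta>: "0 < \<delta> \<and> \<delta> < pi"
  let ?F = "at 0 within (Z ` cusp R s \<inter> sector (- of_real s) \<delta>)"
  have aux: "(\<lambda>z. Q (- 1 / Fi z) - (\<Sum>k<M. a k * z ^ Suc k)) \<in> O[?F](\<lambda>z. z ^ (M + 1))" for M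
    by (rule asymptotic_cusp_aux[OF s R a Qstep Qlim]) (use \<delta> in auto)
  show "(\<lambda>z. Q (- 1 / Fi z) - (\<Sum>k<N. fps_nth (fps_X * Abs_fps a) k * z ^ k)) \<in> O[?F](\<lambda>z. z ^ N)"
  \<comment> \<open>\<open>fps_X\<close> shifts the coefficients by one, so truncation at N uses the
    previous bound with N - 1 terms; for N = 0 the bound O(z) is weakened to O(1).\<close>
  proof (cases N)
    case 0
    have "(\<lambda>z::complex. z) \<in> O[?F](\<lambda>_. 1)"
      by (rule bigoI_tendsto[of _ _ 0]) auto
    with aux[of 0] show ?thesis using 0 landau_o.big_trans by fastforce
  next
    case (Suc M)
    have "(\<Sum>k<N. fps_nth (fps_X * Abs_fps a) k * z ^ k) = (\<Sum>k<M. a k * z ^ Suc k)" for z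
      unfolding Suc by (subst sum.lessThan_Suc_shift) simp
    then show ?thesis using aux[of M] Suc by simp
  qed
qed

text \<open>
  Modulo the coboundary of a function vanishing at infinity, the right-hand side of the equation
  for R may be replaced by - c, so that the jump of R is the two-sided sum of c.
\<close>

lemma one_moment_pair_of_jump:
  fixes \<tau> c :: "complex \<Rightarrow> complex" and W :: real
  assumes h: "h1 analytic_on {0}" "h2 analytic_on {0}"
    and \<tau>: "(\<tau> \<longlongrightarrow> 0) at_infinity"
    and coboundary: "\<And>w. norm w > W \<Longrightarrow> B (Z w) = \<tau> (w + 1) - \<tau> w - c w"
    and sum_c: "\<And>w. \<bar>Im w\<bar> > W \<Longrightarrow>
      (\<lambda>n. (\<Sum>k<n. c (w + of_nat k)) + (\<Sum>k<n. c (w - 1 - of_nat k)))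
        \<longlonglongrightarrow> (if Im w > 0 then h1 (exp (2 * pi * \<i> * w)) else - h2 (exp (- 2 * pi * \<i> * w)))"
  shows "one_moment_pair f h1 h2"
proof -
  obtain W0 M where b: "W0 \<ge> 2 / r" "(\<lambda>w. B (Z w)) holomorphic_on {w. norm w > W0}"
    "\<And>w. norm w > W0 \<Longrightarrow> norm (B (Z w)) \<le> M / norm w ^ 2"
    using B_orbit_summand by metis
  \<comment> \<open>\<open>W\<close> gives access to \<open>coboundary\<close> and
    \<open>sum_c\<close>, \<open>W0\<close> to the bound of the summand, 2 / r to the petals, and
    \<open>A\<close> makes Im z and Im w agree in sign on the overlap.\<close>
  define R where "R = max W (max W0 (max A (2 / r)))"
  have R: "R \<ge> 2 / r" "R \<ge> W" "R \<ge> W0" "R \<ge> A" by (auto simp: R_def)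
  have r12: "1 / r \<ge> 1" "2 / r = 1 / r + 1 / r" using r by (simp_all add: field_simps)
  have R1: "R \<ge> 1" using R(1) r12 by linarith
  have big: "norm w > R" if "w \<in> cusp R s" "s = 1 \<or> s = - 1" for w s
    using norm_cusp_gt[OF _ R1 that(1)] that(2) by auto
  have sum_locale: "translation_orbit_sum (\<lambda>w. B (Z w)) (cusp R s) s M" if s: "s = 1 \<or> s = - 1" for s
  proof
    show "\<bar>s\<bar> = 1" using s by auto
    show "open (cusp R s)" by (rule open_cusp)
    show "w + of_real s \<in> cusp R s" if "w \<in> cusp R s" for w
      using cusp_step[OF _ that] s by auto
    show "(\<lambda>w. B (Z w)) holomorphic_on cusp R s"
      by (rule holomorphic_on_subset[OF b(2)]) (use big[OF _ s] R(3) in force)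
    show "norm (B (Z w)) \<le> M / norm w ^ 2" if "w \<in> cusp R s" for w
      using b(3)[of w] big[OF that s] R(3) by simp
  qed
  interpret P: translation_orbit_sum "\<lambda>w. B (Z w)" "cusp R 1" 1 M by (rule sum_locale) simp
  interpret N: translation_orbit_sum "\<lambda>w. B (Z w)" "cusp R (- 1)" "- 1" M by (rule sum_locale) simp
  \<comment> \<open>The backward sum starts at w - 1, so that the two half sums together run over w
    + Z without counting w twice.\<close>
  define Qp where "Qp w = - P.S w" for w
  define Qm where "Qm w = N.S (w - 1)" for w
  have sub: "cusp R 1 \<subseteq> {w. norm w > 1 / r}" "cusp R (- 1) \<subseteq> {w. norm w > 1 / r}"
    using R by (intro cusp_subset'; simp)+
  have pred_in: "w - 1 \<in> cusp R (- 1)" if "w \<in> cusp R (- 1)" for w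
    using cusp_step[of "- 1" w R] that by simp
  have Qp_step: "Qp (w + 1) - Qp w = B (Z w)" if "w \<in> cusp R 1" for w
    using P.S_step[OF that] by (simp add: Qp_def)
  have Qm_step: "Qm (w + 1) - Qm w = B (Z w)" if "w \<in> cusp R (- 1)" for w
    using N.S_step[OF that] by (simp add: Qm_def)
  have f_quot: "B (Z w) = - Z w + Ln (f (Z w) / Z w)" if "norm w > 1 / r" for w
    by (rule B_Z[OF that])
  have Zi_hol: "(\<lambda>z. - 1 / Fi z) holomorphic_on Z ` cusp R s" "(\<lambda>z. - 1 / Fi z) ` (Z ` cusp R s) \<subseteq> cusp R s"
    if "s = 1 \<or> s = - 1" for s
    using that sub Zi_Z holomorphic_on_subset[OF Zi_holomorphic Z_image] by (auto simp: subset_iff)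
  have Rp: "R_solution f (Z ` cusp R 1) (\<lambda>z. Qp (- 1 / Fi z))"
    unfolding R_solution_def
  proof (intro conjI ballI impI)
    show "(\<lambda>z. Qp (- 1 / Fi z)) holomorphic_on Z ` cusp R 1"
      unfolding Qp_def using Zi_hol
      by (intro holomorphic_on_minus holomorphic_on_compose_gen[OF _ P.S_holomorphic, unfolded o_def]) auto
    fix z assume "z \<in> Z ` cusp R 1"
    then obtain w where w: "w \<in> cusp R 1" "z = Z w" by blast
    have "w + 1 \<in> cusp R 1" using cusp_step[of 1 w R] w by simp
    then have "norm w > 1 / r" "norm (w + 1) > 1 / r" using w sub by auto
    then show "Qp (- 1 / Fi (f z)) - Qp (- 1 / Fi z) = - z + Ln (f z / z)"
      using Qp_step[OF w(1)] f_quot Zi_Z f_Z w(2) by simp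
  qed
  have Rm: "R_solution f (Z ` cusp R (- 1)) (\<lambda>z. Qm (- 1 / Fi z))"
    unfolding R_solution_def
  proof (intro conjI ballI impI)
    have "(\<lambda>z. - 1 / Fi z - 1) ` (Z ` cusp R (- 1)) \<subseteq> cusp R (- 1)"
      using Zi_hol(2)[of "- 1"] pred_in by auto
    then show "(\<lambda>z. Qm (- 1 / Fi z)) holomorphic_on Z ` cusp R (- 1)"
      unfolding Qm_def using Zi_hol
      by (intro holomorphic_on_compose_gen[OF _ N.S_holomorphic, unfolded o_def]
           holomorphic_on_diff holomorphic_on_const) auto
    fix z assume "z \<in> Z ` cusp R (- 1)"
    then obtain w where w: "w \<in> cusp R (- 1)" "z = Z w" by blast
    \<comment> \<open>On the repelling side w + 1 is controlled by its modulus: 2 / r \<ge> 1 / r +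
      1.\<close>
    have "norm (w + 1) \<ge> norm w - 1" using norm_triangle_ineq4[of "w + 1" 1] by simp
    moreover have "norm w > R" using big[OF w(1)] by simp
    ultimately have "norm w > 1 / r" "norm (w + 1) > 1 / r"
      using R(1) r12 by linarith+
    then show "Qm (- 1 / Fi (f z)) - Qm (- 1 / Fi z) = - z + Ln (f z / z)"
      using Qm_step[OF w(1)] f_quot Zi_Z f_Z w(2) by simp
  qed
  obtain a where a: "\<And>N. (\<lambda>z. (\<Sum>k<N. a k * (f z ^ Suc k - z ^ Suc k)) - B z) \<in> O[at 0](\<lambda>z. z ^ (N + 2))"
    using formal_cohomological_equation[OF f_analytic f_expansion2 B_analytic B_bigo f_0] by blast
  have "asymptotic_on (- of_real 1) (Z ` cusp R 1) (\<lambda>z. Qp (- 1 / Fi z)) (fps_X * Abs_fps a)"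
  proof (rule asymptotic_cusp[OF _ R(1) a])
    show "(\<lambda>n. Qp (w + of_real (1 * real n))) \<longlonglongrightarrow> 0" if "w \<in> cusp R 1" for w
      using tendsto_minus[OF P.S_tail[OF that]] by (simp add: Qp_def)
  qed (use Qp_step in auto)
  then have asp: "asymptotic_on (- 1) (Z ` cusp R 1) (\<lambda>z. Qp (- 1 / Fi z)) (fps_X * Abs_fps a)" by simp
  have "asymptotic_on (- of_real (- 1)) (Z ` cusp R (- 1)) (\<lambda>z. Qm (- 1 / Fi z)) (fps_X * Abs_fps a)"
  proof (rule asymptotic_cusp[OF _ R(1) a])
    show "(\<lambda>n. Qm (w + of_real (- 1 * real n))) \<longlonglongrightarrow> 0" if "w \<in> cusp R (- 1)" for w
      using N.S_tail[OF pred_in[OF that]] by (simp add: Qm_def algebra_simps)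
  qed (use Qm_step in auto)
  \<comment> \<open>The constant is 0, since both half sums tend to 0 along their orbits.\<close>
  then have asm: "asymptotic_on 1 (Z ` cusp R (- 1)) (\<lambda>z. Qm (- 1 / Fi z)) (fps_X * Abs_fps a + fps_const 0)"
    by simp
  have jump: "Qp w - Qm w = (if Im w > 0 then h1 (exp (2 * pi * \<i> * w)) else - h2 (exp (- 2 * pi * \<i> * w)))"
    if w: "w \<in> cusp R 1" "w \<in> cusp R (- 1)" for w
  proof -
    have Im: "\<bar>Im w\<bar> > R" using Im_cusp_Int[OF _ w] R1 by simp
    have n: "norm (w + of_nat k) > W" "norm (w - 1 - of_nat k) > W" for k
      using abs_Im_le_cmod[of "w + of_nat k"] abs_Im_le_cmod[of "w - 1 - of_nat k"] Im R(2) by simp_all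
    have up: "(\<Sum>k<n. B (Z (w + of_nat k))) = \<tau> (w + of_nat n) - \<tau> w - (\<Sum>k<n. c (w + of_nat k))" for n
    proof (induction n)
      case (Suc n)
      have "w + of_nat (Suc n) = w + of_nat n + 1" by simp
      then show ?case by (simp only: sum.lessThan_Suc Suc.IH coboundary[OF n(1)[of n]]) simp
    qed simp
    have down: "(\<Sum>k<n. B (Z (w - 1 - of_nat k))) = \<tau> w - \<tau> (w - of_nat n) - (\<Sum>k<n. c (w - 1 - of_nat k))" for n
    proof (induction n)
      case (Suc n)
      have "w - 1 - of_nat n + 1 = w - of_nat n" "w - of_nat (Suc n) = w - 1 - of_nat n" by simp_all
      then show ?case by (simp only: sum.lessThan_Suc Suc.IH coboundary[OF n(2)[of n]]) simp
    qed simp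
    have lim1: "(\<lambda>n. - (\<Sum>k<n. B (Z (w + of_nat k))) - (\<Sum>k<n. B (Z (w - 1 - of_nat k)))) \<longlonglongrightarrow> - P.S w - N.S (w - 1)"
      using P.S_partial_sums[OF w(1)] N.S_partial_sums[OF pred_in[OF w(2)]]
      by (intro tendsto_diff tendsto_minus) simp_all
    \<comment> \<open>The coboundary telescopes to values of \<tau> at the two ends of the orbit,
      which vanish in the limit.\<close>
    have eq: "(\<lambda>n. - (\<Sum>k<n. B (Z (w + of_nat k))) - (\<Sum>k<n. B (Z (w - 1 - of_nat k))))
        = (\<lambda>n. \<tau> (w + of_real (- 1 * real n)) - \<tau> (w + of_real (1 * real n))
            + ((\<Sum>k<n. c (w + of_nat k)) + (\<Sum>k<n. c (w - 1 - of_nat k))))"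
      by (rule ext) (simp add: up down)
    have lim2: "(\<lambda>n. \<tau> (w + of_real (- 1 * real n)) - \<tau> (w + of_real (1 * real n))
            + ((\<Sum>k<n. c (w + of_nat k)) + (\<Sum>k<n. c (w - 1 - of_nat k)))) \<longlonglongrightarrow>
          0 - 0 + (if Im w > 0 then h1 (exp (2 * pi * \<i> * w)) else - h2 (exp (- 2 * pi * \<i> * w)))"
      using Im R(2)
      by (intro tendsto_add tendsto_diff sum_c filterlim_compose[OF \<tau> orbit_at_infinity]) auto
    from LIMSEQ_unique[OF lim1[unfolded eq] lim2] show ?thesis
      unfolding Qp_def Qm_def by (simp only: diff_self add_0)
  qed
  \<comment> \<open>The components of the overlap are told apart by the sign of Im z, the jump by
    that of Im w. Both signs agree: z differs from - 1 / w by at most A / |w|^2, so Im z |w|^2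
    differs from Im w by at most A, while A \<le> R < |Im w|.\<close>
  have overlap: "\<exists>w. z = Z w \<and> w \<in> cusp R 1 \<and> w \<in> cusp R (- 1) \<and> - 1 / Fi z = w \<and> Im w * Im z > 0"
    if z: "z \<in> Z ` cusp R 1 \<inter> Z ` cusp R (- 1)" for z
  proof -
    obtain w where w: "w \<in> cusp R 1" "z = Z w" using z by blast
    obtain w' where w': "w' \<in> cusp R (- 1)" "z = Z w'" using z by blast
    have "w = w'" using w w' sub inj_onD[OF inj_Z, of w w'] by blast
    have w1: "norm w > 1 / r" using w sub by blast
    have wpos: "norm w > 0" using w1 r12 by linarith
    have Im: "\<bar>Im w\<bar> > R" using Im_cusp_Int[of R w] R1 w w' \<open>w = w'\<close> by simp
    have "norm (z - - 1 / w) \<le> A * norm (- 1 / w) ^ 2"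
      using F_close[OF inv_in_ball[OF w1]] w(2) by (simp add: Z_def)
    then have "\<bar>Im z - Im (- 1 / w)\<bar> \<le> A / norm w ^ 2"
      using abs_Im_le_cmod[of "z - - 1 / w"] by (simp add: norm_divide power_divide)
    moreover have "Im (- 1 / w) = Im w / norm w ^ 2"
      by (simp add: Im_divide cmod_power2)
    ultimately have "\<bar>Im z - Im w / norm w ^ 2\<bar> \<le> A / norm w ^ 2" by simp
    then have "\<bar>Im z - Im w / norm w ^ 2\<bar> * norm w ^ 2 \<le> A"
      using wpos by (simp add: field_simps)
    moreover have "(Im z - Im w / norm w ^ 2) * norm w ^ 2 = Im z * norm w ^ 2 - Im w"
      using wpos by (simp add: left_diff_distrib)
    then have "\<bar>Im z * norm w ^ 2 - Im w\<bar> = \<bar>(Im z - Im w / norm w ^ 2) * norm w ^ 2\<bar>" by simp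
    ultimately have "\<bar>Im z * norm w ^ 2 - Im w\<bar> \<le> A" by (simp add: abs_mult)
    then have "\<bar>Im z * norm w ^ 2 - Im w\<bar> < \<bar>Im w\<bar>" using Im R(4) by linarith
    moreover have "0 < y * x" if "\<bar>x - y\<bar> < \<bar>y\<bar>" for x y :: real
    proof (cases "y > 0")
      case True
      then have "x > 0" using that by linarith
      then show ?thesis using True by simp
    next
      case False
      then have "y < 0" "x < 0" using that by linarith+
      then show ?thesis by (rule mult_neg_neg)
    qed
    ultimately have "0 < Im w * (Im z * norm w ^ 2)" by blast
    then have "0 < Im w * Im z * norm w ^ 2" by (simp only: mult.assoc)
    then have "Im w * Im z > 0" using wpos by (simp add: zero_less_mult_iff)
    then show ?thesis using w w' \<open>w = w'\<close> Zi_Z[OF w1] by blast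
  qed
  show ?thesis
    unfolding one_moment_pair_def
  proof (intro conjI exI)
    show "attracting_petal f (Z ` cusp R 1)" by (rule attracting_petal_cusp[OF R(1)])
    show "repelling_petal f (Z ` cusp R (- 1))" by (rule repelling_petal_cusp[OF R(1)])
    show "attracting_trivialization f (Z ` cusp R 1) (\<lambda>z. - 1 / Fi z)"
      by (rule attracting_trivialization_cusp[OF R(1)])
    show "\<forall>z\<in>Z ` cusp R 1 \<inter> Z ` cusp R (- 1). 0 < Im z \<longrightarrow>
        Qp (- 1 / Fi z) - Qm (- 1 / Fi z) = h1 (exp (2 * pi * \<i> * (- 1 / Fi z)))"
    proof (intro ballI impI)
      fix z assume "z \<in> Z ` cusp R 1 \<inter> Z ` cusp R (- 1)" "0 < Im z"
      then obtain w where "z = Z w" "w \<in> cusp R 1" "w \<in> cusp R (- 1)" "- 1 / Fi z = w" "Im w > 0"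
        using overlap[of z] by (auto simp: zero_less_mult_iff)
      then show "Qp (- 1 / Fi z) - Qm (- 1 / Fi z) = h1 (exp (2 * pi * \<i> * (- 1 / Fi z)))"
        using jump[of w] by (simp only: if_True)
    qed
    show "\<forall>z\<in>Z ` cusp R 1 \<inter> Z ` cusp R (- 1). Im z < 0 \<longrightarrow>
        Qm (- 1 / Fi z) - Qp (- 1 / Fi z) = h2 (exp (- 2 * pi * \<i> * (- 1 / Fi z)))"
    proof (intro ballI impI)
      fix z assume "z \<in> Z ` cusp R 1 \<inter> Z ` cusp R (- 1)" "Im z < 0"
      then obtain w where w: "z = Z w" "w \<in> cusp R 1" "w \<in> cusp R (- 1)" "- 1 / Fi z = w" "Im w < 0"
        using overlap[of z] by (auto simp: zero_less_mult_iff)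
      then have "\<not> Im w > 0" by simp
      with jump[OF w(2,3)] have "Qp w - Qm w = - h2 (exp (- 2 * pi * \<i> * w))" by (simp only: if_False)
      then have "Qm w - Qp w = h2 (exp (- 2 * pi * \<i> * w))" by (metis minus_diff_eq minus_minus)
      then show "Qm (- 1 / Fi z) - Qp (- 1 / Fi z) = h2 (exp (- 2 * pi * \<i> * (- 1 / Fi z)))"
        by (simp only: w(4))
    qed
  qed (fact h Rp Rm asp asm)+
qed

end

section \<open>Realization\<close>

lemma tangent_to_identity_factor:
  fixes F :: "complex \<Rightarrow> complex"
  assumes F: "F analytic_on {0}" "F 0 = 0" "(F has_field_derivative 1) (at 0)"
  shows "\<exists>p. p analytic_on {0} \<and> p 0 = 1 \<and> (\<forall>u. F u = u * p u)"
proof -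
  obtain p where p: "p analytic_on {0}" "\<And>u. F u = u * p u"
    using analytic_divide_id[OF F(1,2)] by blast
  obtain p' where "(p has_field_derivative p') (at 0)"
    using analytic_on_imp_differentiable_at[OF p(1)] by (auto simp: field_differentiable_def)
  then have "((\<lambda>u. u * p u) has_field_derivative p 0) (at 0)"
    by (auto intro!: derivative_eq_intros)
  moreover have "F = (\<lambda>u. u * p u)" using p(2) by (simp add: fun_eq_iff)
  ultimately have "p 0 = 1" using F(3) DERIV_unique by blast
  with p show ?thesis by blast
qed

lemma model_conjugacy_exists:
  fixes F :: "complex \<Rightarrow> complex"
  assumes F: "F analytic_on {0}" "F 0 = 0" "(F has_field_derivative 1) (at 0)"
  shows "\<exists>Fi r A. model_conjugacy F Fi r A"
proof -
  obtain p where p: "p analytic_on {0}" "p 0 = 1" "\<And>u. F u = u * p u"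
    using tangent_to_identity_factor[OF F] by blast
  have "(\<lambda>u. p u - 1) analytic_on {0}" using p(1) by (intro analytic_intros)
  from analytic_divide_id[OF this] obtain k where k: "k analytic_on {0}" "\<And>u. p u - 1 = u * k u"
    using p(2) by auto
  have quad: "F u - u = u^2 * k u" for u
  proof -
    have "F u - u = u * (p u - 1)" by (simp add: p(3) algebra_simps)
    then show ?thesis by (simp only: k(2) power2_eq_square mult.assoc)
  qed
  define A where "A = norm (k 0) + 1"
  have A: "A > 0" by (simp add: A_def add_nonneg_pos)
  have "\<forall>\<^sub>F u in nhds 0. norm (k u) < A"
    using analytic_at_imp_isCont[OF k(1)]
    by (intro order_tendstoD[of _ "norm (k 0)"]) (auto simp: A_def isCont_def tendsto_at_iff_tendsto_nhds intro!: tendsto_norm)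
  then obtain r1 where r1: "r1 > 0" "\<And>u. norm u < r1 \<Longrightarrow> norm (k u) < A"
    by (auto simp: eventually_nhds_metric dist_norm)
  obtain r2 where r2: "r2 > 0" "F holomorphic_on ball 0 r2"
    using F(1) by (auto simp: analytic_on_def)
  have "deriv F 0 \<noteq> 0" using DERIV_imp_deriv[OF F(3)] by simp
  moreover have "(0::complex) \<in> ball 0 r2" using r2(1) by simp
  ultimately obtain r3 where r3: "r3 > 0" "inj_on F (ball 0 r3)"
    using has_complex_derivative_locally_injective[OF r2(2) _ open_ball] by metis
  \<comment> \<open>\<open>r1\<close> serves the quadratic bound, \<open>r2\<close> holomorphy,
    \<open>r3\<close> injectivity, and 1 / (4 A) the smallness of A r.\<close>
  define r where "r = min (min r1 r2) (min r3 (min 1 (1 / (4 * A))))"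
  have r: "r > 0" "r \<le> r1" "r \<le> r2" "r \<le> r3" "r \<le> 1" "r \<le> 1 / (4 * A)"
    using r1 r2 r3 A by (auto simp: r_def)
  have hol: "F holomorphic_on ball 0 r"
    by (rule holomorphic_on_subset[OF r2(2)]) (use r in auto)
  have inj: "inj_on F (ball 0 r)"
    by (rule inj_on_subset[OF r3(2)]) (use r in auto)
  obtain Fi where Fi: "Fi holomorphic_on F ` ball 0 r" "\<And>u. u \<in> ball 0 r \<Longrightarrow> Fi (F u) = u"
    using holomorphic_has_inverse[OF hol open_ball inj] by metis
  have "model_conjugacy F Fi r A"
  proof
    show "norm (F u - u) \<le> A * norm u ^ 2" if "u \<in> ball 0 r" for u
    proof -
      have "norm (k u) \<le> A" using r1(2)[of u] that r by auto
      then show ?thesis unfolding quad norm_mult norm_power 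
        by (subst mult.commute) (rule mult_right_mono; simp)
    qed
    show "A * r \<le> 1 / 4" using mult_left_mono[OF r(6), of A] A by simp
  qed (use r A hol Fi in auto)
  then show ?thesis by blast
qed

lemma analytic_tendsto_nhds:
  fixes k :: "complex \<Rightarrow> complex"
  assumes "k analytic_on {a}" shows "(k \<longlongrightarrow> k a) (nhds a)"
  using analytic_at_imp_isCont[OF assms] by (simp add: isCont_def tendsto_at_iff_tendsto_nhds)

lemma tendsto_Ln_nhds:
  fixes p :: "complex \<Rightarrow> complex"
  assumes "p analytic_on {0}" "p 0 = 1"
  shows "((\<lambda>u. Ln (p u)) \<longlongrightarrow> 0) (nhds 0)"
proof -
  have "(\<lambda>u. Ln (p u)) analytic_on {0}" using assms by (intro analytic_intros) auto
  then have "((\<lambda>u. Ln (p u)) \<longlongrightarrow> Ln (p 0)) (nhds 0)"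
    by (rule analytic_tendsto_nhds)
  then show ?thesis using assms(2) by simp
qed

lemma one_moment_pair_exists:
  assumes h: "h1 analytic_on {0}" "h2 analytic_on {0}" and h0: "h1 0 = 0" "h2 0 = 0"
  shows "\<exists>f. prenormalized f \<and> one_moment_pair f h1 h2"
proof -
  obtain \<rho>1 \<rho>2 where \<rho>: "\<rho>1 > 0" "h1 holomorphic_on ball 0 \<rho>1" "\<rho>2 > 0" "h2 holomorphic_on ball 0 \<rho>2"
    using h by (auto simp: analytic_on_def)
  \<comment> \<open>Because exp (2 pi K0) \<ge> K0 \<ge> 1 / \<rho>, the disc of radius exp (- 2 pi
    K0) lies in the domains of both germs.\<close>
  define K0 where "K0 = max 1 (max (1 / \<rho>1) (1 / \<rho>2))"
  have K0: "K0 \<ge> 1" "K0 \<ge> 1 / \<rho>1" "K0 \<ge> 1 / \<rho>2" by (auto simp: K0_def)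
  define K where "K = K0 + 1"
  have exp_le: "exp (- 2 * pi * K0) \<le> \<rho>" if "\<rho> > 0" "K0 \<ge> 1 / \<rho>" for \<rho>
  proof -
    have "1 * K0 \<le> (2 * pi) * K0" using pi_ge_two K0 by (intro mult_right_mono) auto
    then have "K0 \<le> exp (2 * pi * K0)" using exp_ge_add_one_self[of "2 * pi * K0"] by linarith
    then have "1 / \<rho> \<le> exp (2 * pi * K0)" using that by linarith
    then show ?thesis using that(1) by (simp add: exp_minus field_simps)
  qed
  interpret T1: segment_transform h1 K0 K
  proof
    show "h1 holomorphic_on ball 0 (exp (- 2 * pi * K0))"
      using holomorphic_on_subset[OF \<rho>(2)] exp_le[OF \<rho>(1) K0(2)] subset_ball by blast
  qed (use h0 in \<open>auto simp: K_def\<close>)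
  interpret T2: segment_transform h2 K0 K
  proof
    show "h2 holomorphic_on ball 0 (exp (- 2 * pi * K0))"
      using holomorphic_on_subset[OF \<rho>(4)] exp_le[OF \<rho>(3) K0(3)] subset_ball by blast
  qed (use h0 in \<open>auto simp: K_def\<close>)
  have E_an: "T1.E analytic_on {0}" "T2.E analytic_on {0}"
    using T1.E_holomorphic T2.E_holomorphic unfolding analytic_at
    by (metis abs_ge_zero add_nonneg_pos centre_in_ball divide_pos_pos open_ball zero_less_one)+
  have E_refl: "(\<lambda>u. T2.E (- u)) analytic_on {0}"
    using analytic_on_compose[of "\<lambda>u. - u" "{0}" T2.E] E_an(2)
    by (simp add: o_def analytic_on_neg analytic_on_ident)
  \<comment> \<open>The parametrization of the period-one orbits: in the coordinate w = - 1 / u it reads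
    Ln (1 - 1 / w) + T1.C w - T2.C (- w), and its sums along w + Z are the prescribed jumps.
    The first term, of sums constant in each half plane, provides the tangency to the identity.\<close>
  define F where "F u = Ln (1 + u) + u * T1.E u + u * T2.E (- u)" for u
  have F_an: "F analytic_on {0}"
    unfolding F_def using E_an(1) E_refl by (intro analytic_intros) auto
  have F0: "F 0 = 0" by (simp add: F_def)
  \<comment> \<open>The products with \<open>T1.E\<close> and \<open>T2.E\<close> have derivative 0
    at 0, as both transforms vanish there by the zero mean of \<open>G\<close>.\<close>
  have F'0: "(F has_field_derivative 1) (at 0)"
  proof -
    obtain e1 e2 where e: "(T1.E has_field_derivative e1) (at 0)" "((\<lambda>u. T2.E (- u)) has_field_derivative e2) (at 0)"
      using analytic_on_imp_differentiable_at[OF E_an(1)] analytic_on_imp_differentiable_at[OF E_refl]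
      by (auto simp: field_differentiable_def)
    have "((\<lambda>u. Ln (1 + u)) has_field_derivative 1) (at 0)"
      by (auto intro!: derivative_eq_intros)
    from DERIV_add[OF DERIV_add[OF this DERIV_mult[OF DERIV_ident e(1)]] DERIV_mult[OF DERIV_ident e(2)]]
    show ?thesis by (simp add: F_def[abs_def] T1.E_0 T2.E_0)
  qed
  from model_conjugacy_exists[OF F_an F0 F'0] obtain Fi r A where "model_conjugacy F Fi r A" by blast
  then interpret model_conjugacy F Fi r A .
  obtain p where p: "p analytic_on {0}" "p 0 = 1" "\<And>u. F u = u * p u"
    using tangent_to_identity_factor[OF F_an F0 F'0] by blast
  have L: "((\<lambda>u. Ln (1 + u)) \<longlongrightarrow> 0) (nhds (0::complex))" "((\<lambda>u. Ln (p u)) \<longlongrightarrow> 0) (nhds 0)"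
    by (rule tendsto_Ln_nhds; use p in \<open>auto intro!: analytic_intros\<close>)+
  have "(p \<longlongrightarrow> 1) (nhds 0)" using analytic_tendsto_nhds[OF p(1)] p(2) by simp
  then have "\<forall>\<^sub>F u in nhds 0. p u \<noteq> 0" by (rule tendsto_imp_eventually_ne) simp
  moreover have "\<forall>\<^sub>F u in nhds (0::complex). norm (Ln (1 + u)) < 1" "\<forall>\<^sub>F u in nhds 0. norm (Ln (p u)) < 1"
    using order_tendstoD(2)[OF tendsto_norm[OF L(1)], of 1] order_tendstoD(2)[OF tendsto_norm[OF L(2)], of 1] by simp_all
  ultimately have "\<forall>\<^sub>F u in nhds 0. p u \<noteq> 0 \<and> norm (Ln (1 + u)) < 1 \<and> norm (Ln (p u)) < 1"
    by eventually_elim auto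
  then obtain \<eta> where \<eta>: "\<eta> > 0" "\<And>u. norm u < \<eta> \<Longrightarrow> p u \<noteq> 0 \<and> norm (Ln (1 + u)) < 1 \<and> norm (Ln (p u)) < 1"
    by (auto simp: eventually_nhds_metric dist_norm)
  \<comment> \<open>With u = - 1 / w and u' = - 1 / (w + 1), the quotient F u' / F u is (u' / u) (p
    u' / p u), and u' / u = 1 + u'. So Ln (f z / z) yields the increment of Ln p and the value Ln (1
    + u'), which with - Ln (1 + u) from - F u forms another increment; \<tau> collects both.\<close>
  define \<tau> where "\<tau> w = Ln (1 + - 1 / w) + Ln (p (- 1 / w))" for w
  define c where "c w = T1.C w - T2.C (- w)" for w
  \<comment> \<open>The extra 1 keeps w + 1, like w, outside radius 1 / \<eta>.\<close>
  define W where "W = max K (max (1 / r) (1 / \<eta> + 1))"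
  have "one_moment_pair f h1 h2"
  proof (rule one_moment_pair_of_jump[OF h, of \<tau> W c])
    have "filterlim (\<lambda>w::complex. - 1 / w) (nhds 0) at_infinity"
      by (rule tendsto_divide_0[OF tendsto_const filterlim_ident])
    from tendsto_add[OF filterlim_compose[OF L(1) this] filterlim_compose[OF L(2) this]]
    show "(\<tau> \<longlongrightarrow> 0) at_infinity" unfolding \<tau>_def by simp
  next
    fix w :: complex assume w: "norm w > W"
    define u u' where "u = - 1 / w" and "u' = - 1 / (w + 1)"
    have w1: "norm w > 1 / r" "norm w > 1 / \<eta> + 1" using w by (auto simp: W_def)
    have "norm (w + 1) \<ge> norm w - 1" using norm_triangle_ineq4[of "w + 1" 1] by simp
    then have n: "norm w > 1 / \<eta>" "norm (w + 1) > 1 / \<eta>" using w1(2) by linarith+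
    have pos: "norm w > 0" "norm (w + 1) > 0" using n \<eta>(1) by (meson divide_pos_pos less_trans zero_less_one)+
    then have ne: "w \<noteq> 0" "w + 1 \<noteq> 0" by auto
    have small: "norm u < \<eta>" "norm u' < \<eta>"
      using n pos \<eta>(1) by (simp_all add: u_def u'_def norm_divide field_simps)
    note b = \<eta>(2)[OF small(1)] \<eta>(2)[OF small(2)]
    let ?L = "Ln (1 + u') + Ln (p u') - Ln (p u)"
    have u0: "u \<noteq> 0" "u' \<noteq> 0" using ne by (auto simp: u_def u'_def)
    have u'1: "1 + u' \<noteq> 0"
      using ne by (simp add: u'_def field_simps)
    have "exp ?L = (1 + u') * p u' / p u"
      using b u'1 by (simp add: exp_add exp_diff)
    also have "\<dots> = F u' / F u"
    proof -
      have "1 + u' = u' / u" using ne by (simp add: u_def u'_def field_simps)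
      then show ?thesis by (simp only: p(3)) simp
    qed
    finally have exp_L: "exp ?L = F u' / F u" .
    \<comment> \<open>Three logarithms of modulus below 1 keep the sum in the strip |Im| < 3 < pi,
      so no multiple of 2 pi i separates it from the principal logarithm.\<close>
    have "\<bar>Im ?L\<bar> \<le> norm ?L" by (rule abs_Im_le_cmod)
    also have "norm ?L \<le> norm (Ln (1 + u')) + norm (Ln (p u')) + norm (Ln (p u))"
      by (intro order_trans[OF norm_triangle_ineq4] add_mono norm_triangle_ineq order_refl)
    also have "\<dots> < 3" using b by linarith
    finally have "\<bar>Im ?L\<bar> < pi" using pi_gt3 by linarith
    then have "Ln (F u' / F u) = ?L"
      using exp_L by (intro Ln_unique) (auto simp: abs_less_iff)
    moreover have "f (Z w) = F u'" "Z w = F u"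
      using f_Z[OF w1(1)] by (simp_all add: Z_def u_def u'_def)
    ultimately have "B (Z w) = - F u + ?L"
      using B_Z[OF w1(1)] by simp
    moreover have "F u = Ln (1 + u) + c w"
    proof -
      have "T1.C w = u * T1.E u" using T1.C_conv_E[OF u0(1)] ne by (simp add: u_def)
      moreover have "T2.C (- w) = - u * T2.E (- u)" using T2.C_conv_E[of "- u"] u0(1) ne by (simp add: u_def)
      ultimately show ?thesis by (simp add: F_def c_def)
    qed
    ultimately show "B (Z w) = \<tau> (w + 1) - \<tau> w - c w"
      by (simp add: \<tau>_def u_def u'_def)
  next
    fix w :: complex assume w: "\<bar>Im w\<bar> > W"
    have wK: "\<bar>Im w\<bar> > K" "K > 0" using w K0(1) by (auto simp: W_def K_def)
    \<comment> \<open>Negation exchanges the halves of the orbit: - (w - 1 - k) = (1 - w) + k. Hence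
      the sum for the second germ is based at 1 - w rather than - w, which periodicity makes
      harmless.\<close>
    have G2: "T2.G (1 - w) = h2 (exp (- 2 * pi * \<i> * w))"
      using T2.G_periodic[of "- w" 1] by (simp add: T2.G_def)
    have "(\<lambda>n. ((\<Sum>k<n. T1.C (w + of_nat k)) + (\<Sum>k<n. T1.C (w - 1 - of_nat k)))
           - ((\<Sum>k<n. T2.C (1 - w + of_nat k)) + (\<Sum>k<n. T2.C (1 - w - 1 - of_nat k))))
        \<longlonglongrightarrow> (if Im w > K then T1.G w else 0) - (if Im (1 - w) > K then T2.G (1 - w) else 0)"
      using wK by (intro tendsto_diff T1.two_sided_sum_C T2.two_sided_sum_C) auto
    moreover have "(if Im w > K then T1.G w else 0) - (if Im (1 - w) > K then T2.G (1 - w) else 0)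
        = (if Im w > 0 then h1 (exp (2 * pi * \<i> * w)) else - h2 (exp (- 2 * pi * \<i> * w)))"
    proof (cases "Im w > 0")
      case True
      then have "Im w > K" "\<not> Im (1 - w) > K" using wK by auto
      then show ?thesis using True by (simp only: if_True if_False T1.G_def) simp
    next
      case False
      then have "\<not> Im w > K" "Im (1 - w) > K" using wK by auto
      then show ?thesis using False G2 by (simp only: if_True if_False) simp
    qed
    moreover have "((\<Sum>k<n. T1.C (w + of_nat k)) + (\<Sum>k<n. T1.C (w - 1 - of_nat k)))
           - ((\<Sum>k<n. T2.C (1 - w + of_nat k)) + (\<Sum>k<n. T2.C (1 - w - 1 - of_nat k)))
        = (\<Sum>k<n. c (w + of_nat k)) + (\<Sum>k<n. c (w - 1 - of_nat k))" for n
    proof -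
      have "1 - w + of_nat k = - (w - 1 - of_nat k)" "1 - w - 1 - of_nat k = - (w + of_nat k)" for k
        by simp_all
      then show ?thesis unfolding c_def sum_subtractf by (simp only:) simp
    qed
    ultimately show "(\<lambda>n. (\<Sum>k<n. c (w + of_nat k)) + (\<Sum>k<n. c (w - 1 - of_nat k)))
        \<longlonglongrightarrow> (if Im w > 0 then h1 (exp (2 * pi * \<i> * w)) else - h2 (exp (- 2 * pi * \<i> * w)))"
      by (simp only:)
  qed
  then show ?thesis using prenormalized_f by blast
qed

theorem proposition8:
  fixes g\<^sub>1 g\<^sub>2 :: "complex \<Rightarrow> complex"
  assumes "g\<^sub>1 analytic_on {0}" and "g\<^sub>2 analytic_on {0}" and "g\<^sub>1 0 + g\<^sub>2 0 = 0"
  shows "\<exists>f. prenormalized f \<and> (g\<^sub>1, g\<^sub>2) \<in> one_moment f"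
proof -
  define h1 h2 where "h1 t = g\<^sub>1 t - g\<^sub>1 0" and "h2 t = g\<^sub>2 t - g\<^sub>2 0" for t
  have "h1 analytic_on {0}" "h2 analytic_on {0}"
    using assms(1,2) unfolding h1_def h2_def by (auto intro!: analytic_intros)
  then obtain f where f: "prenormalized f" "one_moment_pair f h1 h2"
    using one_moment_pair_exists[of h1 h2] by (auto simp: h1_def h2_def)
  \<comment> \<open>This is what lets the single constant a = \<open>g\<^sub>1 0\<close>, with b =
    1, restore both values at 0.\<close>
  have "g\<^sub>2 0 = - g\<^sub>1 0" using assms(3) by (simp add: eq_neg_iff_add_eq_0 add.commute)
  then have "moment_equiv (g\<^sub>1, g\<^sub>2) (h1, h2)"
    unfolding moment_equiv_def by (intro exI[of _ "g\<^sub>1 0"] exI[of _ 1]) (simp add: h1_def h2_def)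
  with f show ?thesis unfolding one_moment_def by force
qed

end
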